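(* For any $n\ge2$ and $k\ge2$, $H^1(T_{n,k},H)\cong\mathbf{Z}$, and it is generated by the class of Morita's crossed homomorphism $f_M$ (regarded as a crossed homomorphism $T_{n,k}\to H$).
   Context: $F_n$ is the free group on $x_1,\ldots,x_n$, $\Gamma_n(k)$ its lower central series, $H=F_n^{\mathrm{ab}}$, $N_{n,k}=F_n/\Gamma_n(k+1)$, and $T_{n,k}$ is the image of the natural homomorphism $\mathrm{Aut}\,F_n\to\mathrm{Aut}\,N_{n,k}$, whose kernel is denoted $\mathcal{A}_n(k)$; thus $T_{n,k}\cong\mathrm{Aut}\,F_n/\mathcal{A}_n(k)$. $T_{n,k}$ acts on $H$ naturally. Convention: $\mathrm{Aut}\,F_n$ acts on $F_n$ from the right, $x\mapsto x^\sigma$, $x^{\sigma\tau}=(x^\sigma)^\tau$, and a crossed homomorphism $f$ to a right module satisfies $f(\sigma\tau)=f(\sigma)^\tau+f(\tau)$. Morita's crossed homomorphism: let $\partial/\partial x_j:\mathbf{Z}[F_n]\to\mathbf{Z}[F_n]$ be the Fox free derivatives, $\mathfrak{a}:\mathbf{Z}[F_n]\to\mathbf{Z}[H]$ the ring homomorphism induced by abelianization, and $r_M(\sigma)=\big((\partial x_i^\sigma/\partial x_j)^{\mathfrak{a}}\big)_{i,j}\in\mathrm{GL}(n,\mathbf{Z}[H])$ for $\sigma\in\mathrm{Aut}\,F_n$ (Magnus representation). Let $\mathrm{sgn}(\sigma)\in\{\pm1\}$ be the determinant of the automorphism of $H$ induced by $\sigma$. Then $f_M(\sigma)=\mathrm{sgn}(\sigma)\det(r_M(\sigma))$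 lies in the multiplicative subgroup $H\subset\mathbf{Z}[H]^\times$, and $f_M:\mathrm{Aut}\,F_n\to H$ is a crossed homomorphism (with $H$ written additively). It vanishes on $\mathcal{A}_n(2)$, hence induces, for every $k\ge2$, a crossed homomorphism $T_{n,k}\to H$, also called Morita's crossed homomorphism. *)

theory Defs
  imports
    "HOL-Algebra.Elementary_Groups"
    "HOL-Algebra.Generated_Groups"
    "HOL-Algebra.Bij"
    "HOL-Analysis.Determinants"
    "HOL-Library.Poly_Mapping"
begin

section \<open>Free groups\<close>

text \<open>
  A letter \<open>(i, True)\<close> stands for \<open>x\<^sub>i\<close>, a letter \<open>(i, False)\<close> for the inverse of \<open>x\<^sub>i\<close>.
  The free group is the type of words modulo insertion and deletion of cancelling pairs.  It is
  written additively (as a non-commutative \<^class>\<open>group_add\<close>), because the convolution product of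
  \<^typ>\<open>'g \<Rightarrow>\<^sub>0 int\<close> is the group ring product of \<open>Z[G]\<close> for an additively written group.
\<close>

inductive cancels :: "('n \<times> bool) list \<Rightarrow> ('n \<times> bool) list \<Rightarrow> bool" where
  "cancels (u @ [(i, b), (i, \<not> b)] @ v) (u @ v)"

quotient_type 'n free_group = "('n \<times> bool) list" / "equivclp cancels"
  by simp

lemma equivclp_map:
  assumes "equivclp r x y" and "\<And>x y. r x y \<Longrightarrow> equivclp s (f x) (f y)"
  shows "equivclp s (f x) (f y)"
  using assms(1)
proof (induction rule: equivclp_induct)
  case base
  show ?case by simp
next
  case (step y z)
  from step(2) have "equivclp s (f y) (f z)"
    by (auto intro: assms(2) equivclp_sym)
  with step.IH show ?case
    by (rule equivclp_trans)
qed

lemma equivclp_invariant: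
  assumes "equivclp r x y" and "\<And>x y. r x y \<Longrightarrow> f x = f y"
  shows "f x = f y"
  using assms(1) by (induction rule: equivclp_induct) (auto dest: assms(2))

lemma cancels_append_left: "cancels u v \<Longrightarrow> cancels (w @ u) (w @ v)"
  by (auto elim!: cancels.cases) (metis append.assoc append_Cons append_Nil cancels.intros)

lemma cancels_append_right: "cancels u v \<Longrightarrow> cancels (u @ w) (v @ w)"
  by (auto elim!: cancels.cases) (metis append_Cons append_Nil cancels.intros)

lemma equivclp_append:
  assumes "equivclp cancels u u'" "equivclp cancels v v'"
  shows "equivclp cancels (u @ v) (u' @ v')"
proof (rule equivclp_trans)
  show "equivclp cancels (u @ v) (u' @ v)"
    using assms(1)
    by (rule equivclp_map[where f = "\<lambda>w. w @ v"]) (auto dest: cancels_append_right)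
  show "equivclp cancels (u' @ v) (u' @ v')"
    using assms(2)
    by (rule equivclp_map[where f = "\<lambda>w. u' @ w"]) (auto dest: cancels_append_left)
qed

definition word_inverse :: "('n \<times> bool) list \<Rightarrow> ('n \<times> bool) list" where
  "word_inverse w = rev (map (\<lambda>(i, b). (i, \<not> b)) w)"

lemma cancels_word_inverse: "cancels u v \<Longrightarrow> cancels (word_inverse u) (word_inverse v)"
proof (erule cancels.cases)
  fix p i b q
  assume "u = p @ [(i :: 'a, b), (i, \<not> b)] @ q" "v = p @ q"
  then show ?thesis
    using cancels.intros[of "word_inverse q" i b "word_inverse p"]
    by (simp add: word_inverse_def)
qed

lemma word_inverse_left: "equivclp cancels (word_inverse w @ w) []"
proof (induction w)
  case Nil
  show ?case by (simp add: word_inverse_def)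
next
  case (Cons a w)
  obtain i b where a: "a = (i, b)" by (cases a)
  have "cancels (word_inverse w @ [(i, \<not> b), (i, \<not> \<not> b)] @ w) (word_inverse w @ w)"
    by (rule cancels.intros)
  then have "equivclp cancels (word_inverse (a # w) @ a # w) (word_inverse w @ w)"
    by (auto simp: a word_inverse_def)
  with Cons.IH show ?case
    by (blast intro: equivclp_trans)
qed

instantiation free_group :: (type) group_add
begin

lift_definition zero_free_group :: "'a free_group" is "[]" .

lift_definition plus_free_group :: "'a free_group \<Rightarrow> 'a free_group \<Rightarrow> 'a free_group"
  is "(@)"
  by (rule equivclp_append)

lift_definition uminus_free_group :: "'a free_group \<Rightarrow> 'a free_group"
  is word_inverse
  by (erule equivclp_map) (auto dest: cancels_word_inverse)

definition minus_free_group :: "'a free_group \<Rightarrow> 'a free_group \<Rightarrow> 'a free_group" where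
  "x - y = x + - y" for x y :: "'a free_group"

instance
proof
  fix a b c :: "'a free_group"
  show "a + b + c = a + (b + c)" by transfer simp
  show "0 + a = a" by transfer simp
  show "a + 0 = a" by transfer simp
  show "- a + a = 0" by transfer (rule word_inverse_left)
  show "a + - b = a - b" by (simp add: minus_free_group_def)
qed

end

lift_definition gen :: "'n \<Rightarrow> 'n free_group" is "\<lambda>i. [(i, True)]" .

definition free_grp :: "'n free_group monoid" where
  "free_grp = \<lparr>carrier = UNIV, monoid.mult = (+), one = 0\<rparr>"

lemma F_simps [simp]: "carrier free_grp = UNIV" "monoid.mult free_grp = (+)" "one free_grp = 0"
  by (simp_all add: free_grp_def)

lemma group_F: "group free_grp"
  by (rule groupI) (auto simp: add.assoc intro: left_minus)

lemma inv_F [simp]: "m_inv free_grp x = - x"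
  by (rule group.inv_equality[OF group_F]) simp_all


section \<open>The abelianization \<open>H\<close>\<close>

lemma derived_F_normal: "derived free_grp UNIV \<lhd> free_grp"
  using group.derived_self_is_normal[OF group_F] by simp

lemma derived_F_subgroup: "subgroup (derived free_grp UNIV) free_grp"
  by (rule normal_imp_subgroup[OF derived_F_normal])

lemma derived_F_add: "x \<in> derived free_grp UNIV \<Longrightarrow> y \<in> derived free_grp UNIV \<Longrightarrow> x + y \<in> derived free_grp UNIV"
  using subgroup.m_closed[OF derived_F_subgroup, of x y] by simp

lemma derived_F_uminus: "x \<in> derived free_grp UNIV \<Longrightarrow> - x \<in> derived free_grp UNIV"
  using subgroup.m_inv_closed[OF derived_F_subgroup, of x] by simp

lemma derived_F_zero: "0 \<in> derived free_grp UNIV"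
  using subgroup.one_closed[OF derived_F_subgroup] by simp

lemma derived_F_conj: "x \<in> derived free_grp UNIV \<Longrightarrow> a + x - a \<in> derived free_grp UNIV"
  using normal.inv_op_closed2[OF derived_F_normal, of a x] by simp

lemma derived_F_commutator: "a + b - a - b \<in> derived free_grp UNIV"
proof -
  have "a \<otimes>\<^bsub>free_grp\<^esub> b \<otimes>\<^bsub>free_grp\<^esub> inv\<^bsub>free_grp\<^esub> a \<otimes>\<^bsub>free_grp\<^esub> inv\<^bsub>free_grp\<^esub> b \<in> derived free_grp UNIV"
    unfolding derived_def by (rule generate.incl) blast
  then show ?thesis by simp
qed

definition ab_eq :: "'n free_group \<Rightarrow> 'n free_group \<Rightarrow> bool" where
  "ab_eq x y \<longleftrightarrow> x - y \<in> derived free_grp (carrier free_grp)"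

quotient_type 'n free_ab = "'n free_group" / ab_eq
proof (rule equivpI)
  show "reflp ab_eq"
    by (auto simp: reflp_def ab_eq_def derived_F_zero)
  show "symp ab_eq"
    unfolding symp_def ab_eq_def by (metis F_simps(1) derived_F_uminus minus_diff_eq)
  show "transp ab_eq"
  proof (rule transpI)
    fix x y z :: "'a free_group"
    assume "ab_eq x y" "ab_eq y z"
    then have "(x - y) + (y - z) \<in> derived free_grp UNIV"
      unfolding ab_eq_def by (auto intro: derived_F_add)
    then show "ab_eq x z"
      by (simp add: ab_eq_def add_diff_eq)
  qed
qed

instantiation free_ab :: (type) ab_group_add
begin

lift_definition zero_free_ab :: "'a free_ab" is 0 .

lift_definition plus_free_ab :: "'a free_ab \<Rightarrow> 'a free_ab \<Rightarrow> 'a free_ab" is "(+)"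
proof -
  fix a a' b b' :: "'a free_group"
  assume "ab_eq a a'" "ab_eq b b'"
  then have "(a + (b - b') - a) + (a - a') \<in> derived free_grp UNIV"
    unfolding ab_eq_def by (auto intro: derived_F_add derived_F_conj)
  then have "a + (b - b') - a' \<in> derived free_grp UNIV"
    by (simp add: add_diff_eq)
  then have "(a + (b - b') - a') + (a' + b' - a' - b') \<in> derived free_grp UNIV"
    by (intro derived_F_add derived_F_commutator)
  moreover have "(a + (b - b') - a') + (a' + b' - a' - b') = (a + b) - (b' + a')"
    by (simp add: diff_conv_add_uminus add.assoc minus_add del: add_uminus_conv_diff)
  ultimately have "(a + b - (b' + a')) + (b' + a' - b' - a') \<in> derived free_grp UNIV"
    by (metis derived_F_add derived_F_commutator)
  moreover have "(a + b - (b' + a')) + (b' + a' - b' - a') = (a + b) - (a' + b')"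
    by (simp add: diff_conv_add_uminus add.assoc minus_add del: add_uminus_conv_diff)
  ultimately show "ab_eq (a + b) (a' + b')"
    by (simp add: ab_eq_def)
qed

lift_definition uminus_free_ab :: "'a free_ab \<Rightarrow> 'a free_ab" is uminus
proof -
  fix a b :: "'a free_group"
  assume "ab_eq a b"
  then have "- (a - b) \<in> derived free_grp UNIV"
    unfolding ab_eq_def F_simps by (rule derived_F_uminus)
  then have "- b + - (a - b) - - b \<in> derived free_grp UNIV"
    by (rule derived_F_conj)
  then show "ab_eq (- a) (- b)"
    by (simp add: ab_eq_def diff_conv_add_uminus add.assoc minus_add del: add_uminus_conv_diff)
qed

definition minus_free_ab :: "'a free_ab \<Rightarrow> 'a free_ab \<Rightarrow> 'a free_ab" where
  "x - y = x + - y" for x y :: "'a free_ab"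

instance
proof
  fix a b c :: "'a free_ab"
  show "a + b + c = a + (b + c)"
    by transfer (simp add: add.assoc ab_eq_def derived_F_zero)
  show "a + b = b + a"
  proof transfer
    fix a b :: "'a free_group"
    show "ab_eq (a + b) (b + a)"
      using derived_F_commutator[of a b]
      by (simp add: ab_eq_def diff_conv_add_uminus add.assoc minus_add del: add_uminus_conv_diff)
  qed
  show "0 + a = a" by transfer (simp add: ab_eq_def derived_F_zero)
  show "- a + a = 0" by transfer (simp add: ab_eq_def derived_F_zero)
  show "a - b = a + - b" by (simp add: minus_free_ab_def)
qed

end

definition ab_class :: "'n free_group \<Rightarrow> 'n free_ab" where
  "ab_class = abs_free_ab"

text \<open>The exponent sum of \<open>x\<^sub>j\<close>; on \<open>H\<close> it is the coordinate at the basis element \<open>ab_class (gen j)\<close>.\<close>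

primrec word_expsum :: "'n \<Rightarrow> ('n \<times> bool) list \<Rightarrow> int" where
  "word_expsum j [] = 0"
| "word_expsum j (a # w) =
     (if fst a = j then (if snd a then 1 else - 1) else 0) + word_expsum j w"

lemma word_expsum_append: "word_expsum j (u @ v) = word_expsum j u + word_expsum j v"
  by (induction u) auto

lift_definition expsum :: "'n \<Rightarrow> 'n free_group \<Rightarrow> int" is word_expsum
  by (erule equivclp_invariant) (auto elim!: cancels.cases simp: word_expsum_append)

lemma expsum_add: "expsum j (x + y) = expsum j x + expsum j y"
  by transfer (rule word_expsum_append)

lemma expsum_zero: "expsum j 0 = 0"
  by transfer simp

lemma expsum_uminus: "expsum j (- x) = - expsum j x"
  using expsum_add[of j "- x" x] by (simp add: expsum_zero)

lemma expsum_derived: "x \<in> derived free_grp UNIV \<Longrightarrow> expsum j x = 0"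
  unfolding derived_def
  by (induction rule: generate.induct)
     (auto simp: expsum_zero expsum_add expsum_uminus diff_conv_add_uminus
           simp del: add_uminus_conv_diff)

lift_definition coord :: "'n \<Rightarrow> 'n free_ab \<Rightarrow> int" is expsum
proof -
  fix j and x y :: "'n free_group"
  assume "ab_eq x y"
  then have "expsum j (x - y) = 0"
    by (simp add: ab_eq_def expsum_derived)
  then show "expsum j x = expsum j y"
    by (simp add: expsum_add expsum_uminus diff_conv_add_uminus del: add_uminus_conv_diff)
qed


section \<open>Automorphisms, lower central series and \<open>T\<close>\<close>

text \<open>
  Automorphisms act from the right: the product \<open>\<sigma>\<tau>\<close> is "first \<open>\<sigma>\<close>, then \<open>\<tau>\<close>", which is opposite
  to the composition used by \<^const>\<open>AutoGroup\<close>.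
\<close>

definition opposite_group :: "'a monoid \<Rightarrow> 'a monoid" where
  "opposite_group G = G\<lparr>monoid.mult := \<lambda>x y. y \<otimes>\<^bsub>G\<^esub> x\<rparr>"

definition Aut :: "('a, 'b) monoid_scheme \<Rightarrow> ('a \<Rightarrow> 'a) monoid" where
  "Aut G = opposite_group (AutoGroup G)"

definition commutators :: "('a, 'b) monoid_scheme \<Rightarrow> 'a set \<Rightarrow> 'a set \<Rightarrow> 'a set" where
  "commutators G A B =
     generate G (\<Union>x\<in>A. \<Union>y\<in>B. {x \<otimes>\<^bsub>G\<^esub> y \<otimes>\<^bsub>G\<^esub> inv\<^bsub>G\<^esub> x \<otimes>\<^bsub>G\<^esub> inv\<^bsub>G\<^esub> y})"

text \<open>The indexing starts at 1: \<open>lower_central G 1\<close> is the whole group.\<close>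

definition lower_central :: "('a, 'b) monoid_scheme \<Rightarrow> nat \<Rightarrow> 'a set" where
  "lower_central G k = ((\<lambda>A. commutators G A (carrier G)) ^^ (k - 1)) (carrier G)"

definition N_grp :: "nat \<Rightarrow> 'n free_group set monoid" where
  "N_grp k = free_grp Mod lower_central free_grp (k + 1)"

text \<open>
  Elements of \<^term>\<open>N_grp k\<close> are cosets, on which an automorphism of the free group acts by taking
  images.
\<close>

definition induced :: "nat \<Rightarrow> ('n free_group \<Rightarrow> 'n free_group) \<Rightarrow>
    'n free_group set \<Rightarrow> 'n free_group set" where
  "induced k \<sigma> = (\<lambda>X\<in>carrier (N_grp k). \<sigma> ` X)"

definition T_grp :: "nat \<Rightarrow> ('n free_group set \<Rightarrow> 'n free_group set) monoid" where
  "T_grp k = (Aut (N_grp k))\<lparr>carrier := induced k ` carrier (Aut free_grp)\<rparr>"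

text \<open>
  The function on \<^term>\<open>T_grp k\<close> induced by a function on the automorphism group of the free group
  which is constant on the fibres of the projection \<^term>\<open>induced k\<close>.
\<close>

definition descend :: "nat \<Rightarrow> (('n free_group \<Rightarrow> 'n free_group) \<Rightarrow> 'c) \<Rightarrow>
    ('n free_group set \<Rightarrow> 'n free_group set) \<Rightarrow> 'c" where
  "descend k \<phi> = (\<lambda>\<tau>\<in>carrier (T_grp k). the_elem (\<phi> ` {\<sigma> \<in> carrier (Aut free_grp). induced k \<sigma> = \<tau>}))"

text \<open>The action on \<open>H\<close>: the class of \<open>w\<close> is sent to the class of \<open>\<sigma> w\<close>.\<close>

definition ab_act :: "('n free_group \<Rightarrow> 'n free_group) \<Rightarrow> 'n free_ab \<Rightarrow> 'n free_ab" where
  "ab_act \<sigma> h = the_elem ((\<lambda>w. ab_class (\<sigma> w)) ` {w. ab_class w = h})"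

definition T_act :: "nat \<Rightarrow> ('n free_group set \<Rightarrow> 'n free_group set) \<Rightarrow> 'n free_ab \<Rightarrow> 'n free_ab" where
  "T_act k = descend k ab_act"


section \<open>Morita's crossed homomorphism\<close>

text \<open>
  Fox derivatives: \<open>\<partial>x\<^sub>i/\<partial>x\<^sub>j\<close> is the Kronecker delta and
  \<open>\<partial>(uv)/\<partial>x\<^sub>j = \<partial>u/\<partial>x\<^sub>j + u \<partial>v/\<partial>x\<^sub>j\<close> for group elements \<open>u\<close>, \<open>v\<close>; consequently
  \<open>\<partial>x\<^sub>j\<^sup>-\<^sup>1/\<partial>x\<^sub>j = - x\<^sub>j\<^sup>-\<^sup>1\<close>.
\<close>

primrec fox_word :: "'n \<Rightarrow> ('n \<times> bool) list \<Rightarrow> ('n free_group \<Rightarrow>\<^sub>0 int)" where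
  "fox_word j [] = 0"
| "fox_word j (a # w) =
     (let x = gen (fst a) in
      if snd a
      then (if fst a = j then 1 else 0) + Poly_Mapping.single x 1 * fox_word j w
      else (if fst a = j then - Poly_Mapping.single (- x) 1 else 0)
             + Poly_Mapping.single (- x) 1 * fox_word j w)"

lemma fox_word_cancel: "fox_word j ((i, b) # (i, \<not> b) # v) = fox_word j v"
  by (auto simp: Let_def ring_distribs mult.assoc [symmetric] mult_single)

lift_definition fox_elem :: "'n \<Rightarrow> 'n free_group \<Rightarrow> ('n free_group \<Rightarrow>\<^sub>0 int)" is fox_word
proof (erule equivclp_invariant)
  fix j :: 'n and x y :: "('n \<times> bool) list"
  assume "cancels x y"
  then obtain u i b v where xy: "x = u @ (i, b) # (i, \<not> b) # v" "y = u @ v"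
    by (auto elim!: cancels.cases)
  have "fox_word j (u @ (i, b) # (i, \<not> b) # v) = fox_word j (u @ v)"
  proof (induction u)
    case Nil
    show ?case by (simp only: append_Nil fox_word_cancel)
  next
    case (Cons a u)
    then show ?case by (simp only: append_Cons fox_word.simps)
  qed
  then show "fox_word j x = fox_word j y" by (simp only: xy)
qed

lemma fox_elem_gen: "fox_elem j (gen i) = (if i = j then 1 else 0)"
  by (simp add: fox_elem.abs_eq gen_def)

lemma fox_word_append:
  "fox_word j (u @ v) =
     fox_word j u + Poly_Mapping.single (abs_free_group u) 1 * fox_word j v"
proof (induction u)
  case Nil
  have "abs_free_group [] = (0 :: 'a free_group)" by (simp add: zero_free_group_def)
  then show ?case by simp
next
  case (Cons a u)
  have "abs_free_group (a # u) =
      (if snd a then gen (fst a) else - gen (fst a)) + abs_free_group u"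
    by (cases a)
       (simp add: gen_def plus_free_group.abs_eq uminus_free_group.abs_eq word_inverse_def)
  then have "Poly_Mapping.single (abs_free_group (a # u)) (1 :: int) =
      Poly_Mapping.single (if snd a then gen (fst a) else - gen (fst a)) 1 *
      Poly_Mapping.single (abs_free_group u) 1"
    by (simp add: mult_single)
  with Cons.IH show ?case
    by (simp add: Let_def ring_distribs mult.assoc add.assoc)
qed

lemma fox_elem_add:
  "fox_elem j (x + y) = fox_elem j x + Poly_Mapping.single x 1 * fox_elem j y"
proof -
  obtain u v where "x = abs_free_group u" "y = abs_free_group v"
    by (metis Quotient3_abs_rep Quotient3_free_group)
  then show ?thesis
    by (simp add: plus_free_group.abs_eq fox_elem.abs_eq fox_word_append)
qed

definition Z_linear_extension :: "('g \<Rightarrow> 'r::ring_1) \<Rightarrow> ('g \<Rightarrow>\<^sub>0 int) \<Rightarrow> 'r" where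
  "Z_linear_extension f p = (\<Sum>g\<in>Poly_Mapping.keys p. of_int (Poly_Mapping.lookup p g) * f g)"

definition fox :: "'n \<Rightarrow> ('n free_group \<Rightarrow>\<^sub>0 int) \<Rightarrow> ('n free_group \<Rightarrow>\<^sub>0 int)" where
  "fox j = Z_linear_extension (fox_elem j)"

definition abelianize :: "('n free_group \<Rightarrow>\<^sub>0 int) \<Rightarrow> ('n free_ab \<Rightarrow>\<^sub>0 int)" where
  "abelianize = Z_linear_extension (\<lambda>w. Poly_Mapping.single (ab_class w) 1)"

definition magnus :: "('n::finite free_group \<Rightarrow> 'n free_group) \<Rightarrow> ('n free_ab \<Rightarrow>\<^sub>0 int)^'n^'n" where
  "magnus \<sigma> = (\<chi> i j. abelianize (fox j (Poly_Mapping.single (\<sigma> (gen i)) 1)))"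

definition det_sgn :: "('n::finite free_group \<Rightarrow> 'n free_group) \<Rightarrow> int" where
  "det_sgn \<sigma> = det (\<chi> i j. coord j (ab_act \<sigma> (ab_class (gen i))))"

text \<open>
  \<open>H\<close> sits inside the units of \<open>Z[H]\<close> as the elements \<open>single h 1\<close>; for an automorphism
  \<open>\<sigma>\<close> the signed determinant is such an element.
\<close>

definition morita :: "('n::finite free_group \<Rightarrow> 'n free_group) \<Rightarrow> 'n free_ab" where
  "morita \<sigma> = (THE h. Poly_Mapping.single h 1 = of_int (det_sgn \<sigma>) * det (magnus \<sigma>))"

definition morita_T :: "nat \<Rightarrow> ('n::finite free_group set \<Rightarrow> 'n free_group set) \<Rightarrow> 'n free_ab" where
  "morita_T k = descend k morita"


section \<open>First cohomology with coefficients in a right module\<close>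

text \<open>
  \<open>act \<sigma> m\<close> is the right action of \<open>\<sigma>\<close> on \<open>m\<close>.  Cochains are extensional, so that
  equality of functions is equality on the carrier of \<open>G\<close>.
\<close>

definition Z1 :: "('g, 'b) monoid_scheme \<Rightarrow> ('g \<Rightarrow> 'm \<Rightarrow> 'm) \<Rightarrow> ('g \<Rightarrow> 'm::ab_group_add) monoid" where
  "Z1 G act =
    \<lparr>carrier = {f \<in> extensional (carrier G).
        \<forall>\<sigma>\<in>carrier G. \<forall>\<tau>\<in>carrier G. f (\<sigma> \<otimes>\<^bsub>G\<^esub> \<tau>) = act \<tau> (f \<sigma>) + f \<tau>},
     monoid.mult = \<lambda>f g. \<lambda>\<sigma>\<in>carrier G. f \<sigma> + g \<sigma>,
     one = \<lambda>\<sigma>\<in>carrier G. 0\<rparr>"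

definition B1 :: "('g, 'b) monoid_scheme \<Rightarrow> ('g \<Rightarrow> 'm \<Rightarrow> 'm) \<Rightarrow> ('g \<Rightarrow> 'm::ab_group_add) set" where
  "B1 G act = range (\<lambda>m. \<lambda>\<sigma>\<in>carrier G. act \<sigma> m - m)"

definition H1 :: "('g, 'b) monoid_scheme \<Rightarrow> ('g \<Rightarrow> 'm \<Rightarrow> 'm) \<Rightarrow> ('g \<Rightarrow> 'm::ab_group_add) set monoid" where
  "H1 G act = Z1 G act Mod B1 G act"

definition H1_class :: "('g, 'b) monoid_scheme \<Rightarrow> ('g \<Rightarrow> 'm \<Rightarrow> 'm) \<Rightarrow> ('g \<Rightarrow> 'm::ab_group_add) \<Rightarrow>
    ('g \<Rightarrow> 'm) set" where
  "H1_class G act f = B1 G act #>\<^bsub>Z1 G act\<^esub> f"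

end

theory Submission
  imports Defs
begin

text \<open>
  Pulled back along \<open>Aut F\<^sub>n \<rightarrow> T\<^bsub>n,k\<^esub>\<close>, a cocycle is determined by its values on
  Nielsen's generators: signed permutations and transvections \<open>x\<^sub>i \<mapsto> x\<^sub>i x\<^sub>j\<close>.  The
  automorphism \<open>\<iota>\<close> inverting all generators acts on \<open>H\<close> by \<open>- 1\<close> and is centralized by the signed
  permutations, so a cocycle vanishing at \<open>\<iota>\<close> vanishes on all of them.  A parity argument shows that
  adding a multiple of \<open>f\<^sub>M\<close> and a coboundary makes any cocycle vanish at \<open>\<iota>\<close>; its value at
  \<open>x\<^sub>i \<mapsto> x\<^sub>i x\<^sub>j\<close> is then forced to be \<open>b e\<^sub>j\<close> with \<open>b\<close> independent of \<open>i, j\<close>.  The same holds, with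
  \<open>b = - 1\<close>, for \<open>2 f\<^sub>M - \<delta>(e\<^sub>1 + \<dots> + e\<^sub>n)\<close>, which disposes of the remaining freedom.

  That \<open>f\<^sub>M\<close> takes values in \<open>H\<close> is checked on the same generators, and \<open>f\<^sub>M\<close> descends to
  \<open>T\<^bsub>n,k\<^esub>\<close> because Fox derivatives of elements of \<open>\<Gamma>\<^sub>n(3)\<close> lie in the square of the augmentation
  ideal, modulo which distinct elements of \<open>H\<close> remain distinct.
\<close>

section \<open>Reduced words\<close>

text \<open>Aut F_n enters only through generators, never through a presentation: relations bound
  the space of cocycles from above and the explicit cocycle f_M realizes the bound, so no cocycle
  has to be built from prescribed values. Once a cocycle vanishes on signed permutations, three
  kinds of relation suffice: a sign change commutes with a transvection whose indices it avoids,
  inverting x_j turns \<open>transvection i j\<close> into its inverse, and permutations carry any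
  transvection to any other.

  The obstacle is division by two. A coboundary takes only even values at the inversion of all
  generators, so the parity left over must be absorbed by f_M, whose value there is -(e_1 + ... +
  e_n), odd in every coordinate. This is also why twice f_M, rather than f_M itself, gets compared
  with a coboundary.

  The passage to T costs little: Aut F_n maps onto T and both act on H in the same way, so an
  equation between a cocycle, a multiple of f_M and the coboundary of h can be tested on
  automorphisms, with the same h. Only the descent of f_M uses k \<ge> 2, and only the infinite
  order of its class uses n \<ge> 2.\<close>

definition flip_letter :: "'n \<times> bool \<Rightarrow> 'n \<times> bool" where
  "flip_letter a = (fst a, \<not> snd a)"

lemma flip_letter_simps [simp]:
  "flip_letter (flip_letter a) = a" "fst (flip_letter a) = fst a" "snd (flip_letter a) = (\<not> snd a)"
  "flip_letter a \<noteq> a" "a \<noteq> flip_letter a"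
  by (auto simp: flip_letter_def prod_eq_iff)

lemma flip_letter_eq_iff [simp]: "flip_letter a = flip_letter b \<longleftrightarrow> a = b"
  by (metis flip_letter_simps(1))

lemma word_inverse_simps [simp]:
  "word_inverse [] = []"
  "word_inverse (a # w) = word_inverse w @ [flip_letter a]"
  "word_inverse (u @ v) = word_inverse v @ word_inverse u"
  by (auto simp: word_inverse_def flip_letter_def case_prod_beta)

lemma word_inverse_invol [simp]: "word_inverse (word_inverse w) = w"
  by (induction w) auto

lemma word_inverse_eq_Nil [simp]: "word_inverse u = [] \<longleftrightarrow> u = []" "[] = word_inverse u \<longleftrightarrow> u = []"
  by (cases u; auto)+

lemma length_word_inverse [simp]: "length (word_inverse w) = length w"
  by (simp add: word_inverse_def)

definition reduced :: "('n \<times> bool) list \<Rightarrow> bool" where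
  "reduced = successively (\<lambda>a b. b \<noteq> flip_letter a)"

lemma reduced_simps [simp]:
  "reduced []" "reduced [a]" "reduced (a # b # w) \<longleftrightarrow> b \<noteq> flip_letter a \<and> reduced (b # w)"
  by (auto simp: reduced_def)

lemma reduced_append:
  "reduced (u @ v) \<longleftrightarrow> reduced u \<and> reduced v \<and> (u = [] \<or> v = [] \<or> hd v \<noteq> flip_letter (last u))"
  by (auto simp: reduced_def successively_append_iff)

lemma reduced_Cons: "reduced (a # v) \<longleftrightarrow> reduced v \<and> (v = [] \<or> hd v \<noteq> flip_letter a)"
  by (cases v) auto

lemma reduced_word_inverse [simp]: "reduced (word_inverse w) = reduced w"
proof (induction w)
  case (Cons a w)
  then show ?case
    by (cases w) (auto simp: reduced_append)
qed simp

fun reducing_cons :: "'n \<times> bool \<Rightarrow> ('n \<times> bool) list \<Rightarrow> ('n \<times> bool) list" where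
  "reducing_cons a [] = [a]"
| "reducing_cons a (b # w) = (if b = flip_letter a then w else a # b # w)"

definition reduce :: "('n \<times> bool) list \<Rightarrow> ('n \<times> bool) list" where
  "reduce w = foldr reducing_cons w []"

lemma reduced_reducing_cons: "reduced w \<Longrightarrow> reduced (reducing_cons a w)"
  by (cases w) (auto simp: reduced_Cons)

lemma reduced_foldr_reducing_cons: "reduced v \<Longrightarrow> reduced (foldr reducing_cons w v)"
  by (induction w) (auto intro: reduced_reducing_cons)

text \<open>Van der Waerden's argument: on reduced words, prepending a letter and prepending its
  inverse undo each other. Hence \<open>reduce\<close> does not see cancelling pairs, and normal
  forms are unique without a confluence argument.\<close>

lemma reducing_cons_cancel: "reduced w \<Longrightarrow> reducing_cons a (reducing_cons (flip_letter a) w) = w"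
  by (cases w rule: remdups_adj.cases) auto

lemma reduce_reduced: "reduced w \<Longrightarrow> reduce w = w"
proof (induction w)
  case (Cons a w)
  then show ?case
    by (cases w) (auto simp: reduce_def)
qed (simp add: reduce_def)

lemma abs_reducing_cons: "abs_free_group (reducing_cons a w) = abs_free_group (a # w)"
proof (cases w)
  case (Cons b v)
  show ?thesis
  proof (cases "b = flip_letter a")
    case True
    have "cancels ([] @ [(fst a, snd a), (fst a, \<not> snd a)] @ v) ([] @ v)"
      by (rule cancels.intros)
    then have "equivclp cancels (a # b # v) v"
      by (auto simp: True flip_letter_def)
    then have "equivclp cancels v (a # b # v)"
      by (rule equivclp_sym)
    then show ?thesis
      by (simp add: Cons True free_group.abs_eq_iff)
  qed (simp add: Cons)
qed simp

lemma abs_free_group_append: "abs_free_group (u @ v) = abs_free_group u + abs_free_group v"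
  by (simp add: plus_free_group.abs_eq)

lemma abs_free_group_Nil [simp]: "abs_free_group [] = 0"
  by (simp add: zero_free_group_def)

lemma abs_free_group_word_inverse: "abs_free_group (word_inverse w) = - abs_free_group w"
  by (simp add: uminus_free_group.abs_eq)

lemma abs_reduce: "abs_free_group (reduce w) = abs_free_group w"
proof (induction w)
  case (Cons a w)
  have "abs_free_group (reduce (a # w)) = abs_free_group ([a] @ reduce w)"
    by (simp add: reduce_def abs_reducing_cons)
  also have "\<dots> = abs_free_group ([a] @ w)"
    by (simp only: abs_free_group_append Cons.IH)
  finally show ?case by simp
qed (simp add: reduce_def)

lift_definition nf :: "'n free_group \<Rightarrow> ('n \<times> bool) list" is reduce
proof (erule equivclp_invariant)
  fix u v :: "('n \<times> bool) list"
  assume "cancels u v"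
  then obtain p a q where *: "u = p @ [a, flip_letter a] @ q" "v = p @ q"
    by (auto elim!: cancels.cases simp: flip_letter_def)
  show "reduce u = reduce v"
    using reducing_cons_cancel[of "foldr reducing_cons q []" a]
    by (simp add: * reduce_def reduced_foldr_reducing_cons)
qed

lemma abs_nf [simp]: "abs_free_group (nf g) = g"
proof -
  obtain u where "g = abs_free_group u"
    by (metis Quotient3_abs_rep Quotient3_free_group)
  then show ?thesis by (simp add: nf.abs_eq abs_reduce)
qed

lemma reduced_nf [simp]: "reduced (nf g)"
proof -
  obtain u where "g = abs_free_group u"
    by (metis Quotient3_abs_rep Quotient3_free_group)
  then show ?thesis by (simp add: nf.abs_eq reduce_def reduced_foldr_reducing_cons)
qed

lemma nf_abs: "reduced w \<Longrightarrow> nf (abs_free_group w) = w"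
  by (simp add: nf.abs_eq reduce_reduced)

lemma nf_inject [simp]: "nf g = nf h \<longleftrightarrow> g = h"
  by (metis abs_nf)

lemma nf_zero [simp]: "nf 0 = []"
  using nf_abs[of "[]"] by simp

lemma nf_eq_Nil [simp]: "nf g = [] \<longleftrightarrow> g = 0"
  by (metis nf_zero nf_inject)

lemma nf_uminus: "nf (- g) = word_inverse (nf g)"
  using nf_abs[of "word_inverse (nf g)"] by (simp add: abs_free_group_word_inverse)

definition letter :: "'n \<times> bool \<Rightarrow> 'n free_group" where
  "letter a = (if snd a then gen (fst a) else - gen (fst a))"

lemma abs_singleton: "abs_free_group [a] = letter a"
  by (cases a) (simp add: letter_def gen_def uminus_free_group.abs_eq flip_letter_def)

lemma abs_Cons: "abs_free_group (a # w) = letter a + abs_free_group w"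
  using abs_free_group_append[of "[a]" w] by (simp add: abs_singleton)

lemma nf_letter [simp]: "nf (letter a) = [a]"
  using nf_abs[of "[a]"] by (simp add: abs_singleton)

lemma letter_flip: "letter (flip_letter a) = - letter a"
  by (simp add: letter_def)

lemma letter_inject [simp]: "letter a = letter b \<longleftrightarrow> a = b"
  by (metis list.inject nf_letter)

lemma letter_True: "letter (i, True) = gen i"
  by (simp add: letter_def)

lemma gen_inject [simp]: "gen i = gen j \<longleftrightarrow> i = j"
  by (metis letter_True letter_inject prod.inject)

lemma free_group_induct [case_names zero letter]:
  assumes "P 0" "\<And>a g. P g \<Longrightarrow> P (letter a + g)"
  shows "P g"
proof -
  have "P (abs_free_group w)" for w
    by (induction w) (auto simp: abs_Cons assms)
  from this[of "nf g"] show ?thesis by simp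
qed

text \<open>Letters are peeled off the end of \<open>u\<close> as long as they cancel;
  \<open>r\<close> collects what is lost in \<open>v\<close>. Keeping the three blocks explicit lets
  lengths of products be read off directly.\<close>

lemma maximal_cancellation:
  assumes "reduced u" "reduced v"
  obtains p r q where "u = p @ word_inverse r" "v = r @ q" "reduced (p @ q)"
  using assms
proof (induction u arbitrary: v thesis rule: rev_induct)
  case Nil
  from Nil(1)[of "[]" "[]" v] Nil(3) show ?case by simp
next
  case (snoc a u)
  show ?case
  proof (cases "v = [] \<or> hd v \<noteq> flip_letter a")
    case True
    then show ?thesis
      using snoc(3,4) snoc(2)[of "u @ [a]" "[]" v] by (auto simp: reduced_append reduced_Cons)
  next
    case False
    then obtain v' where v: "v = flip_letter a # v'"
      by (cases v) auto
    from snoc(1)[of v'] snoc(3,4) v obtain p r q where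
      "u = p @ word_inverse r" "v' = r @ q" "reduced (p @ q)"
      by (auto simp: reduced_append reduced_Cons)
    then show ?thesis
      using snoc(2)[of p "flip_letter a # r" q] v by simp
  qed
qed

lemma nf_cancellation:
  obtains p r q where "nf x = p @ word_inverse r" "nf y = r @ q" "reduced (p @ q)" "nf (x + y) = p @ q"
proof -
  obtain p r q where *: "nf x = p @ word_inverse r" "nf y = r @ q" "reduced (p @ q)"
    using maximal_cancellation[of "nf x" "nf y"] by auto
  have "x + y = abs_free_group (nf x) + abs_free_group (nf y)"
    by simp
  also have "\<dots> = abs_free_group (p @ q)"
    by (simp only: * abs_free_group_append abs_free_group_word_inverse add.assoc)
       (simp flip: add.assoc)
  finally show thesis
    using that * nf_abs by metis
qed

section \<open>Universal property of the free group and additive homomorphisms\<close>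

lift_definition free_ext :: "('n \<Rightarrow> 'g::group_add) \<Rightarrow> 'n free_group \<Rightarrow> 'g"
  is "\<lambda>u w. sum_list (map (\<lambda>a. if snd a then u (fst a) else - u (fst a)) w)"
  by (erule equivclp_invariant) (auto elim!: cancels.cases simp: add.assoc[symmetric])

lemma free_ext_add [simp]: "free_ext u (g + h) = free_ext u g + free_ext u h"
  by transfer simp

lemma free_ext_gen [simp]: "free_ext u (gen i) = u i"
  by transfer simp

definition add_hom :: "('a::group_add \<Rightarrow> 'b::group_add) \<Rightarrow> bool" where
  "add_hom f \<longleftrightarrow> (\<forall>x y. f (x + y) = f x + f y)"

lemma add_hom_add: "add_hom f \<Longrightarrow> f (x + y) = f x + f y"
  by (simp add: add_hom_def)

lemma add_hom_zero: "add_hom f \<Longrightarrow> f 0 = 0"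
  using add_hom_add[of f 0 0] by (metis add_0 add_right_cancel)

lemma add_hom_uminus: "add_hom f \<Longrightarrow> f (- x) = - f x"
  using add_hom_add[of f "- x" x] by (simp add: add_hom_zero eq_neg_iff_add_eq_0)

lemma add_hom_diff: "add_hom f \<Longrightarrow> f (x - y) = f x - f y"
  using add_hom_add[of f x "- y"] by (simp add: add_hom_uminus)

lemma add_hom_free_ext [simp]: "add_hom (free_ext u)"
  by (simp add: add_hom_def)

lemma add_hom_comp: "add_hom f \<Longrightarrow> add_hom g \<Longrightarrow> add_hom (f \<circ> g)"
  by (simp add: add_hom_def)

lemma add_hom_eqI:
  assumes "add_hom f" "add_hom g" "\<And>i. f (gen i) = g (gen i)"
  shows "f = g"
proof
  fix x
  show "f x = g x"
    by (induction x rule: free_group_induct)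
       (auto simp: assms add_hom_add add_hom_zero letter_def add_hom_uminus)
qed

section \<open>Nielsen generation of the automorphism group\<close>

definition auts :: "('n free_group \<Rightarrow> 'n free_group) set" where
  "auts = {\<sigma>. bij \<sigma> \<and> add_hom \<sigma>}"

lemma auts_bij: "\<sigma> \<in> auts \<Longrightarrow> bij \<sigma>"
  and auts_add_hom: "\<sigma> \<in> auts \<Longrightarrow> add_hom \<sigma>"
  by (auto simp: auts_def)

lemmas auts_add = add_hom_add[OF auts_add_hom]
  and auts_zero = add_hom_zero[OF auts_add_hom]
  and auts_uminus = add_hom_uminus[OF auts_add_hom]
  and auts_diff = add_hom_diff[OF auts_add_hom]

lemma id_auts: "id \<in> auts"
  by (simp add: auts_def add_hom_def)

lemma comp_auts: "\<sigma> \<in> auts \<Longrightarrow> \<tau> \<in> auts \<Longrightarrow> \<sigma> \<circ> \<tau> \<in> auts"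
  by (auto simp: auts_def add_hom_comp bij_comp)

lemma inv_auts: "\<sigma> \<in> auts \<Longrightarrow> inv_into UNIV \<sigma> \<in> auts"
proof -
  assume *: "\<sigma> \<in> auts"
  then have "inv_into UNIV \<sigma> (x + y) = inv_into UNIV \<sigma> x + inv_into UNIV \<sigma> y" for x y
    using auts_bij[OF *] auts_add[OF *]
    by (intro inv_f_eq) (auto simp: bij_is_inj bij_is_surj surj_f_inv_f)
  with * show ?thesis
    by (auto simp: auts_def add_hom_def bij_imp_bij_inv)
qed

lemma auts_comp_inv: "\<sigma> \<in> auts \<Longrightarrow> \<sigma> \<circ> inv_into UNIV \<sigma> = id" "\<sigma> \<in> auts \<Longrightarrow> inv_into UNIV \<sigma> \<circ> \<sigma> = id"
  by (auto dest!: auts_bij simp: bij_is_inj bij_is_surj surj_iff[symmetric] inj_iff[symmetric])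

lemma autsI:
  assumes "add_hom \<sigma>" "add_hom \<tau>" "\<And>i. \<sigma> (\<tau> (gen i)) = gen i" "\<And>i. \<tau> (\<sigma> (gen i)) = gen i"
  shows "\<sigma> \<in> auts"
proof -
  have "\<sigma> \<circ> \<tau> = id" "\<tau> \<circ> \<sigma> = id"
    using assms by (auto intro!: add_hom_eqI add_hom_comp simp: add_hom_def)
  then have "bij \<sigma>"
    using o_bij by blast
  with assms(1) show ?thesis by (simp add: auts_def)
qed

definition signed_map :: "('n \<Rightarrow> 'n \<times> bool) \<Rightarrow> 'n free_group \<Rightarrow> 'n free_group" where
  "signed_map s = free_ext (\<lambda>i. letter (s i))"

definition transvection :: "'n \<Rightarrow> 'n \<Rightarrow> 'n free_group \<Rightarrow> 'n free_group" where
  "transvection i j = free_ext (\<lambda>k. if k = i then gen i + gen j else gen k)"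

lemma add_hom_signed_map [simp]: "add_hom (signed_map s)"
  by (simp add: signed_map_def)

lemma signed_map_gen [simp]: "signed_map s (gen i) = letter (s i)"
  by (simp add: signed_map_def)

lemma signed_map_id: "signed_map (\<lambda>i. (i, True)) = id"
  by (rule add_hom_eqI[OF add_hom_signed_map auts_add_hom[OF id_auts]]) (simp add: letter_True)

lemma signed_map_letter:
  "signed_map s (letter a) = letter (if snd a then s (fst a) else flip_letter (s (fst a)))"
  by (simp add: letter_flip) (simp add: letter_def add_hom_uminus)

lemma add_hom_transvection [simp]: "add_hom (transvection i j)"
  by (simp add: transvection_def)

lemma transvection_gen [simp]: "transvection i j (gen k) = (if k = i then gen i + gen j else gen k)"
  by (simp add: transvection_def)

lemma signed_map_auts:
  fixes s :: "'n::finite \<Rightarrow> 'n \<times> bool"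
  assumes "inj (fst \<circ> s)"
  shows "signed_map s \<in> auts"
proof -
  define p where "p = inv_into UNIV (fst \<circ> s)"
  have "surj (fst \<circ> s)"
    using assms finite_UNIV_inj_surj finite by blast
  then have 1: "fst (s (p i)) = i" for i
    using surj_f_inv_f[of "fst \<circ> s" i] by (simp add: p_def)
  have 2: "p (fst (s i)) = i" for i
    using inv_f_f[OF assms, of i] by (simp add: p_def)
  show ?thesis
  proof (rule autsI)
    show "add_hom (signed_map s)" "add_hom (signed_map (\<lambda>i. (p i, snd (s (p i)))))" by simp_all
    show "signed_map s (signed_map (\<lambda>i. (p i, snd (s (p i)))) (gen i)) = gen i" for i
      using 1[of i] by (auto simp: letter_def add_hom_uminus)
    show "signed_map (\<lambda>i. (p i, snd (s (p i)))) (signed_map s (gen i)) = gen i" for i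
      by (auto simp: signed_map_letter 2) (auto simp: letter_def)
  qed
qed

lemma transvection_auts: "i \<noteq> j \<Longrightarrow> transvection i j \<in> auts"
  by (rule autsI[where \<tau> = "free_ext (\<lambda>k. if k = i then gen i - gen j else gen k)"])
     (auto simp: add_hom_add add_hom_diff)

section \<open>Word length under automorphisms\<close>

abbreviation glen :: "'n free_group \<Rightarrow> nat" where
  "glen g \<equiv> length (nf g)"

lemma glen_uminus [simp]: "glen (- g) = glen g"
  by (simp add: nf_uminus)

text \<open>Stripping the first and last letters keeps a word self-inverse; at the centre there
  would be a letter equal to its own inverse or an adjacent cancelling pair.\<close>

lemma self_inverse_word:
  assumes "reduced w" "word_inverse w = w"
  shows "w = []"
  using assms
proof (induction "length w" arbitrary: w rule: less_induct)
  case less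
  show ?case
  proof (cases w)
    case (Cons a u)
    show ?thesis
    proof (cases u rule: rev_cases)
      case Nil
      with less(3) Cons show ?thesis by simp
    next
      case (snoc v b)
      with less(3) Cons have *: "b = flip_letter a" "word_inverse v = v" by auto
      with less(1)[of v] less(2) Cons snoc have "v = []"
        by (auto simp: reduced_append reduced_Cons)
      with less(2) * Cons snoc show ?thesis by auto
    qed
  qed simp
qed

text \<open>If more than half of \<open>g\<close> cancelled, the two factorizations of
  \<open>g\<close> would leave a non-empty self-inverse block \<open>t\<close> in the middle. This
  handles a letter multiplied by itself, where no transvection is available to shorten the
  image.\<close>

lemma glen_double: "glen g \<le> glen (g + g)"
proof -
  obtain p r q where *: "nf g = p @ word_inverse r" "nf g = r @ q" "reduced (p @ q)" "nf (g + g) = p @ q"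
    by (rule nf_cancellation)
  then have len: "length p = length q"
    by (metis add.commute add_left_cancel length_append length_word_inverse)
  show ?thesis
  proof (cases "length r \<le> length p")
    case True
    then show ?thesis using * len by simp
  next
    case False
    define t where "t = drop (length p) r"
    from False have "p = take (length p) r"
      using *(1,2) by (metis append_eq_append_conv_if nle_le)
    then have r: "r = p @ t"
      by (metis append_take_drop_id t_def)
    with * have "word_inverse t @ word_inverse p = t @ q"
      by auto
    with len have "word_inverse t = t" by simp
    moreover have "reduced t"
      using * r by (metis reduced_append reduced_nf)
    ultimately have "t = []" by (rule self_inverse_word[rotated])
    with r False show ?thesis by simp
  qed
qed

text \<open>By \<open>N1\<close> at most half of a factor cancels against each neighbour, and by \<open>N2\<close> the two halves of a
  factor do not both cancel, so that at least one letter of every factor survives in the product.\<close>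

lemma nielsen_reduced_expanding:
  assumes \<tau>: "\<tau> \<in> auts"
    and N1: "\<And>a b. b \<noteq> flip_letter a \<Longrightarrow>
      glen (\<tau> (letter a)) \<le> glen (\<tau> (letter a) + \<tau> (letter b)) \<and>
      glen (\<tau> (letter b)) \<le> glen (\<tau> (letter a) + \<tau> (letter b))"
    and N2: "\<And>a b c x p q y. b \<noteq> flip_letter a \<Longrightarrow> c \<noteq> flip_letter b \<Longrightarrow>
      nf (\<tau> (letter a)) = x @ word_inverse p \<Longrightarrow> nf (\<tau> (letter b)) = p @ word_inverse q \<Longrightarrow>
      nf (\<tau> (letter c)) = q @ y \<Longrightarrow> length p = length q \<Longrightarrow> False"
  shows "glen g \<le> glen (\<tau> g)"
proof -
  have ne: "nf (\<tau> (letter a)) \<noteq> []" for a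
  proof
    assume "nf (\<tau> (letter a)) = []"
    then have "\<tau> (letter a) = \<tau> 0"
      using \<tau> by (simp add: auts_zero)
    then have "letter a = 0"
      using auts_bij[OF \<tau>] by (simp add: bij_is_inj inj_eq)
    then show False
      by (metis nf_letter nf_zero not_Cons_self2)
  qed
  \<comment> \<open>Invariant: \<open>c\<close> is the part of the image of \<open>b\<close> already
    lost to the left, \<open>s\<close> is the part that survives so far, and \<open>v\<close> has
    collected at least one letter for every earlier factor. The letter \<open>a\<close> records
    against which image \<open>c\<close> was lost, in the form that \<open>N2\<close>
    requires.\<close>
  have *: "\<exists>v s c. nf (\<tau> (abs_free_group (w @ [b]))) = v @ s \<and> length w \<le> length v \<and>
      nf (\<tau> (letter b)) = c @ s \<and> length c \<le> length s \<and>
      (c \<noteq> [] \<longrightarrow> (\<exists>a x. b \<noteq> flip_letter a \<and> nf (\<tau> (letter a)) = x @ word_inverse c))"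
    if "reduced (w @ [b])" for w b
    using that
  proof (induction w arbitrary: b rule: rev_induct)
    case Nil
    show ?case
      by (rule exI[of _ "[]"], rule exI[of _ "nf (\<tau> (letter b))"], rule exI[of _ "[]"])
         (simp add: abs_singleton)
  next
    case (snoc b w z)
    then have zb: "z \<noteq> flip_letter b" and "reduced (w @ [b])"
      by (auto simp: reduced_append)
    then obtain v s c where IH: "nf (\<tau> (abs_free_group (w @ [b]))) = v @ s" "length w \<le> length v"
      "nf (\<tau> (letter b)) = c @ s" "length c \<le> length s"
      "c \<noteq> [] \<Longrightarrow> \<exists>a x. b \<noteq> flip_letter a \<and> nf (\<tau> (letter a)) = x @ word_inverse c"
      using snoc.IH by blast
    obtain p r q where pq: "nf (\<tau> (letter b)) = p @ word_inverse r" "nf (\<tau> (letter z)) = r @ q"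
      "reduced (p @ q)" "nf (\<tau> (letter b) + \<tau> (letter z)) = p @ q"
      by (rule nf_cancellation)
    from N1[OF zb] pq have len: "length r \<le> length p" "length r \<le> length q" by auto
    have cs: "length c + length s = length p + length r"
      using IH(3) pq(1) by (metis length_append length_word_inverse)
    \<comment> \<open>Otherwise \<open>c\<close> and \<open>r\<close> are exactly the two halves of
      the image of \<open>b\<close> and the factor disappears completely, which \<open>N2\<close>
      excludes.\<close>
    have lt: "length c < length p"
    proof (rule ccontr)
      assume "\<not> ?thesis"
      with cs len IH(4) have eq: "length c = length p" "length p = length r" "length s = length r"
        by linarith+
      then have "c = p"
        using IH(3) pq(1) by simp
      moreover have "c \<noteq> []"
        using eq ne[of b] IH(3) by auto
      ultimately obtain a x where "b \<noteq> flip_letter a" "nf (\<tau> (letter a)) = x @ word_inverse p"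
        using IH(5) by auto
      from N2[OF this(1) zb this(2) pq(1,2) eq(2)] show False .
    qed
    define t where "t = drop (length c) p"
    have "c = take (length c) p"
      using IH(3) pq(1) lt by (metis append_eq_append_conv_if less_imp_le not_le)
    then have p: "p = c @ t"
      by (metis append_take_drop_id t_def)
    with lt have t: "t \<noteq> []" by auto
    from p IH(3) pq(1) have s: "s = t @ word_inverse r" by simp
    have "reduced (v @ s)"
      using IH(1) by (metis reduced_nf)
    then have "reduced (v @ t)" and "reduced (t @ q)"
      using s p pq(3) by (simp_all add: reduced_append) (metis t hd_append2)
    with t have red: "reduced (v @ t @ q)"
      by (auto simp: reduced_append)
    have "\<tau> (abs_free_group ((w @ [b]) @ [z])) = \<tau> (abs_free_group (w @ [b])) + \<tau> (letter z)"
      by (subst abs_free_group_append) (simp add: abs_singleton auts_add[OF \<tau>])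
    also have "\<dots> = abs_free_group (v @ s) + abs_free_group (r @ q)"
      by (simp flip: IH(1) pq(2))
    also have "\<dots> = abs_free_group (v @ t @ q)"
      by (simp only: s abs_free_group_append abs_free_group_word_inverse add.assoc)
         (simp flip: add.assoc)
    finally have "nf (\<tau> (abs_free_group ((w @ [b]) @ [z]))) = (v @ t) @ q"
      using nf_abs[OF red] by simp
    moreover have "length (w @ [b]) \<le> length (v @ t)"
      using IH(2) t by (cases t) auto
    ultimately show ?case
      using pq(1,2) len(2) zb by blast
  qed
  show ?thesis
  proof (cases "nf g" rule: rev_cases)
    case (snoc w b)
    with *[of w b] obtain v s c where
      "nf (\<tau> (abs_free_group (w @ [b]))) = v @ s" "length w \<le> length v"
      "nf (\<tau> (letter b)) = c @ s" "length c \<le> length s"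
      by (metis reduced_nf)
    moreover have "abs_free_group (w @ [b]) = g"
      by (metis abs_nf snoc)
    ultimately show ?thesis using snoc ne[of b]
      by (cases s) auto
  qed simp
qed

text \<open>Expansion, applied to the preimage of a generator, bounds the length of that preimage by
  one, so the inverse carries generators to letters. Two of these letters with the same index would
  be equal or opposite, and so would the two generators.\<close>

lemma expanding_is_signed_map:
  fixes \<tau> :: "'n::finite free_group \<Rightarrow> 'n free_group"
  assumes \<tau>: "\<tau> \<in> auts" and exp: "\<And>g. glen g \<le> glen (\<tau> g)"
  obtains s where "inj (fst \<circ> s)" "inv_into UNIV \<tau> = signed_map s"
proof -
  have i: "inv_into UNIV \<tau> \<in> auts" by (rule inv_auts[OF \<tau>])
  have *: "\<exists>a. inv_into UNIV \<tau> (gen k) = letter a" for k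
  proof -
    have "glen (inv_into UNIV \<tau> (gen k)) \<le> glen (\<tau> (inv_into UNIV \<tau> (gen k)))"
      by (rule exp)
    also have "\<dots> = 1"
      using auts_bij[OF \<tau>] by (simp add: bij_is_surj surj_f_inv_f flip: letter_True)
    finally have "glen (inv_into UNIV \<tau> (gen k)) \<le> 1" .
    moreover have "inv_into UNIV \<tau> (gen k) \<noteq> inv_into UNIV \<tau> 0"
      using bij_is_inj[OF auts_bij[OF i]] nf_letter[of "(k, True)"]
      by (metis inj_eq letter_True nf_zero not_Cons_self2)
    then have "nf (inv_into UNIV \<tau> (gen k)) \<noteq> []"
      using i by (simp add: auts_zero)
    ultimately obtain a where "nf (inv_into UNIV \<tau> (gen k)) = [a]"
      by (cases "nf (inv_into UNIV \<tau> (gen k))") auto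
    then show ?thesis
      by (metis nf_inject nf_letter)
  qed
  then obtain s where s: "\<And>k. inv_into UNIV \<tau> (gen k) = letter (s k)" by metis
  have "inv_into UNIV \<tau> = signed_map s"
    using i by (intro add_hom_eqI) (auto simp: s auts_add_hom)
  moreover have "inj (fst \<circ> s)"
  proof (rule injI)
    fix k l assume "(fst \<circ> s) k = (fst \<circ> s) l"
    then have "s k = s l \<or> s k = flip_letter (s l)"
      by (auto simp: prod_eq_iff)
    then have "inv_into UNIV \<tau> (gen k) = inv_into UNIV \<tau> (gen l) \<or> inv_into UNIV \<tau> (gen k) = inv_into UNIV \<tau> (- gen l)"
      using i by (auto simp: s auts_uminus letter_flip)
    then have "gen k = gen l \<or> gen k = - gen l"
      using bij_is_inj[OF auts_bij[OF i]] by (auto simp: inj_eq)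
    then have "letter (k, True) = letter (l, True) \<or> letter (k, True) = letter (l, False)"
      by (simp add: letter_def)
    then show "k = l" by auto
  qed
  ultimately show thesis using that by blast
qed

section \<open>Ranking words of equal length, and the size that Nielsen's method minimizes\<close>

definition letter_code :: "'n::finite \<times> bool \<Rightarrow> nat" where
  "letter_code = (SOME f. bij_betw f UNIV {0..<CARD('n \<times> bool)})"

lemma letter_code: "bij_betw (letter_code :: 'n \<times> bool \<Rightarrow> nat) UNIV {0..<CARD('n::finite \<times> bool)}"
  unfolding letter_code_def
  by (rule someI_ex[where P = "\<lambda>f. bij_betw f UNIV {0..<CARD('n \<times> bool)}"], rule ex_bij_betw_finite_nat) simp

text \<open>A word is read as a numeral in base 2n with the letter codes as digits, so that words of
  equal length are compared lexicographically by a natural number.\<close>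

primrec word_rank :: "('n::finite \<times> bool) list \<Rightarrow> nat" where
  "word_rank [] = 0"
| "word_rank (a # w) = letter_code a * CARD('n \<times> bool) ^ length w + word_rank w"

lemma word_rank_append:
  fixes u v :: "('n::finite \<times> bool) list"
  shows "word_rank (u @ v) = word_rank u * CARD('n \<times> bool) ^ length v + word_rank v"
  by (induction u) (auto simp: algebra_simps power_add)

lemma word_rank_less:
  fixes u :: "('n::finite \<times> bool) list"
  shows "word_rank u < CARD('n \<times> bool) ^ length u"
proof (induction u)
  case (Cons a u)
  let ?B = "CARD('n \<times> bool)"
  have "letter_code a < ?B"
    using bij_betwE[OF letter_code] by fastforce
  then have "(letter_code a + 1) * ?B ^ length u \<le> ?B * ?B ^ length u"
    by (intro mult_right_mono) auto
  with Cons show ?case by (simp add: algebra_simps)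
qed simp

lemma word_rank_append_less:
  fixes u v :: "('n::finite \<times> bool) list"
  assumes "word_rank u < word_rank v" "length x = length y"
  shows "word_rank (u @ x) < word_rank (v @ y)"
proof -
  let ?B = "CARD('n \<times> bool) ^ length x"
  have "(word_rank u + 1) * ?B \<le> word_rank v * ?B"
    using assms(1) by (intro mult_right_mono) auto
  with word_rank_less[of x] assms(2) show ?thesis
    by (simp add: word_rank_append algebra_simps)
qed

lemma word_rank_inj:
  fixes u v :: "('n::finite \<times> bool) list"
  assumes "word_rank u = word_rank v" "length u = length v"
  shows "u = v"
  using assms(2,1)
proof (induction u v rule: list_induct2)
  case (Cons a u b v)
  let ?B = "CARD('n \<times> bool) ^ length u"
  have "(letter_code a * ?B + word_rank u) div ?B = (letter_code b * ?B + word_rank v) div ?B"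
    using Cons by simp
  then have "letter_code a = letter_code b"
    using word_rank_less[of u] word_rank_less[of v] Cons(1) by simp
  moreover from this have "word_rank u = word_rank v"
    using Cons by simp
  moreover have "inj (letter_code :: 'n \<times> bool \<Rightarrow> nat)"
    by (rule bij_betw_imp_inj_on[OF letter_code])
  ultimately show ?case
    using Cons(2) by (auto simp: inj_eq)
qed simp

definition half_rank :: "'n::finite free_group \<Rightarrow> nat" where
  "half_rank g = word_rank (take ((glen g + 1) div 2) (nf g))"

text \<open>The second component is the classical tie-breaker for equal lengths. Both
  \<open>g\<close> and \<open>- g\<close> enter so that the size does not distinguish an element
  from its inverse: a letter and its inverse belong to the same generator.\<close>

definition nielsen_size :: "'n::finite free_group \<Rightarrow> nat \<times> nat" where
  "nielsen_size g = (glen g, half_rank g + half_rank (- g))"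

lemma nielsen_size_uminus [simp]: "nielsen_size (- g) = nielsen_size g"
  by (simp add: nielsen_size_def)

definition nielsen_less :: "'n::finite free_group \<Rightarrow> 'n free_group \<Rightarrow> bool" where
  "nielsen_less g h \<longleftrightarrow> (nielsen_size g, nielsen_size h) \<in> less_than <*lex*> less_than"

lemma nielsen_less_iff:
  "nielsen_less g h \<longleftrightarrow> glen g < glen h \<or>
     glen g = glen h \<and> half_rank g + half_rank (- g) < half_rank h + half_rank (- h)"
  by (simp add: nielsen_less_def nielsen_size_def)

text \<open>In the product the prefix \<open>q\<close> of \<open>c\<close> is exchanged for the
  smaller \<open>p\<close>. Either more cancels and the length drops, or \<open>y\<close> is at
  least as long as \<open>q\<close>; then the initial half of \<open>c\<close> contains the
  exchanged prefix, while the initial half of the inverse lies within \<open>y\<close> and does not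
  change.\<close>

lemma half_rank_replace:
  fixes b c :: "'n::finite free_group"
  assumes "nf b = p @ word_inverse q" "nf c = q @ y" "length p = length q" "word_rank p < word_rank q"
    and "glen b \<le> glen (b + c)"
  shows "nielsen_less (b + c) c"
proof -
  have "b + c = abs_free_group (nf b) + abs_free_group (nf c)"
    by simp
  also have "\<dots> = abs_free_group (p @ y)"
    by (simp only: assms(1,2) abs_free_group_append abs_free_group_word_inverse add.assoc)
       (simp flip: add.assoc)
  finally have eq: "b + c = abs_free_group (p @ y)" .
  obtain p' r y' where c: "p = p' @ word_inverse r" "y = r @ y'" "reduced (p' @ y')"
    using maximal_cancellation[of p y] assms(1,2) by (metis reduced_append reduced_nf)
  have "abs_free_group (p @ y) = abs_free_group (p' @ y')"
    by (simp only: c(1,2) abs_free_group_append abs_free_group_word_inverse add.assoc)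
       (simp flip: add.assoc)
  with eq have nf1: "nf (b + c) = p' @ y'"
    using nf_abs[OF c(3)] by simp
  show ?thesis
  proof (cases "r = []")
    case False
    then have "glen (b + c) < glen c"
      using c nf1 assms(2,3) by (cases r) auto
    then show ?thesis by (simp add: nielsen_less_iff)
  next
    case True
    with c nf1 have nf: "nf (b + c) = p @ y" by simp
    with assms have len: "length q \<le> length y" by simp
    define h where "h = (length q + length y + 1) div 2"
    have h: "length q \<le> h" "h \<le> length y"
      using len by (auto simp: h_def)
    have "half_rank (b + c) = word_rank (p @ take (h - length q) y)"
      and "half_rank c = word_rank (q @ take (h - length q) y)"
      using h assms(2,3) nf by (simp_all add: half_rank_def h_def)
    then have "half_rank (b + c) < half_rank c"
      using word_rank_append_less[OF assms(4) refl] by metis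
    moreover have "half_rank (- (b + c)) = half_rank (- c)"
      using h assms(2,3) nf unfolding half_rank_def nf_uminus by (simp add: h_def add.commute)
    ultimately show ?thesis
      using nf assms(2,3) by (simp add: nielsen_less_iff)
  qed
qed

text \<open>The length part of the order gives the first condition of
  \<open>nielsen_reduced_expanding\<close>, the rank part the second: if two equally long halves
  both cancelled, multiplying by the neighbour on the suitable side would lower a rank.\<close>

lemma nielsen_minimal_expanding:
  fixes \<tau> :: "'n::finite free_group \<Rightarrow> 'n free_group"
  assumes \<tau>: "\<tau> \<in> auts"
    and min: "\<And>a b. fst a \<noteq> fst b \<Longrightarrow> \<not> nielsen_less (\<tau> (letter a) + \<tau> (letter b)) (\<tau> (letter b))"
  shows "glen g \<le> glen (\<tau> g)"
proof (rule nielsen_reduced_expanding[OF \<tau>])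
  have inj: "a = b" if "\<tau> (letter a) = \<tau> (letter b)" for a b
    using auts_bij[OF \<tau>] that by (simp add: bij_is_inj inj_eq)
  have flip: "\<tau> (letter (flip_letter a)) = - \<tau> (letter a)" for a
    using \<tau> by (simp add: letter_flip auts_uminus)
  have N1: "glen (\<tau> (letter b)) \<le> glen (\<tau> (letter a) + \<tau> (letter b))"
    if "b \<noteq> flip_letter a" for a b
  proof (cases "fst a = fst b")
    case True
    with that have "a = b" by (auto simp: prod_eq_iff)
    then show ?thesis by (simp add: glen_double)
  next
    case False
    then show ?thesis using min[OF False] by (simp add: nielsen_less_iff)
  qed
  have N1': "glen (\<tau> (letter a)) \<le> glen (\<tau> (letter a) + \<tau> (letter b))"
    if "b \<noteq> flip_letter a" for a b
  proof -
    have "flip_letter a \<noteq> flip_letter (flip_letter b)"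
      using that by auto
    from N1[OF this] have "glen (\<tau> (letter a)) \<le> glen (- (\<tau> (letter a) + \<tau> (letter b)))"
      by (simp only: flip minus_add glen_uminus)
    then show ?thesis by (simp only: glen_uminus)
  qed
  show "glen (\<tau> (letter a)) \<le> glen (\<tau> (letter a) + \<tau> (letter b)) \<and>
      glen (\<tau> (letter b)) \<le> glen (\<tau> (letter a) + \<tau> (letter b))"
    if "b \<noteq> flip_letter a" for a b
    using that N1 N1' by blast
  have N2: False if "c \<noteq> flip_letter b" "nf (\<tau> (letter b)) = p @ word_inverse q"
      "nf (\<tau> (letter c)) = q @ y" "length p = length q" "word_rank p < word_rank q" for b c p q y
  proof -
    have "b \<noteq> c"
      using that by auto
    with that(1) have "fst b \<noteq> fst c"
      by (auto simp: prod_eq_iff)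
    from min[OF this] half_rank_replace[OF that(2,3,4,5) N1'[OF that(1)]] show False by simp
  qed
  show False if h: "b \<noteq> flip_letter a" "c \<noteq> flip_letter b"
      "nf (\<tau> (letter a)) = x @ word_inverse p" "nf (\<tau> (letter b)) = p @ word_inverse q"
      "nf (\<tau> (letter c)) = q @ y" "length p = length q" for a b c x p q y
  proof -
    consider "word_rank p < word_rank q" | "word_rank q < word_rank p" | "p = q"
      using word_rank_inj[of p q] h(6) by fastforce
    then show False
    proof cases
      case 1
      with N2[OF h(2,4,5,6)] show False .
    next
      case 2
      \<comment> \<open>The triple is read backwards through inverses, which exchanges
        \<open>p\<close> and \<open>q\<close>.\<close>
      show False
      proof (rule N2[of "flip_letter a" "flip_letter b" q p "word_inverse x"])
        show "flip_letter a \<noteq> flip_letter (flip_letter b)"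
          using h(1) by auto
      qed (use 2 h in \<open>simp_all add: flip nf_uminus\<close>)
    next
      case 3
      \<comment> \<open>Equal halves make the image of \<open>b\<close> equal to its own inverse;
        injectivity then identifies a letter with its inverse.\<close>
      with h(4) have "\<tau> (letter b) = abs_free_group (p @ word_inverse p)"
        by (metis abs_nf)
      then have "\<tau> (letter b) = - \<tau> (letter b)"
        by (simp add: abs_free_group_append abs_free_group_word_inverse)
      then have "b = flip_letter b"
        by (intro inj) (simp add: flip)
      then show False by simp
    qed
  qed
qed

text \<open>The involution \<open>d\<close> only changes signs and sends both letters to inverses of
  generators. Inverting a product reverses its order, so conjugation by \<open>d\<close> turns right
  multiplication of a generator into left multiplication of \<open>b\<close> by \<open>a\<close>,
  whatever the signs.\<close>

definition letter_transvection :: "'n \<times> bool \<Rightarrow> 'n \<times> bool \<Rightarrow> 'n free_group \<Rightarrow> 'n free_group" where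
  "letter_transvection a b =
     (let d = signed_map (\<lambda>k. if k = fst b then flip_letter b else if k = fst a then flip_letter a else (k, True))
      in d \<circ> transvection (fst b) (fst a) \<circ> d)"

lemma letter_transvection:
  assumes "fst a \<noteq> fst b"
  shows "letter_transvection a b (letter b) = letter a + letter b"
    and "k \<noteq> fst b \<Longrightarrow> letter_transvection a b (gen k) = gen k"
proof -
  define s where "s = (\<lambda>k. if k = fst b then flip_letter b else if k = fst a then flip_letter a else (k, True))"
  have T: "letter_transvection a b = signed_map s \<circ> transvection (fst b) (fst a) \<circ> signed_map s"
    by (simp add: letter_transvection_def s_def Let_def)
  have "signed_map s (letter b) = - gen (fst b)"
    by (cases b) (auto simp: signed_map_letter s_def letter_def add_hom_uminus)
  then show "letter_transvection a b (letter b) = letter a + letter b"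
    using assms by (simp add: T add_hom_uminus add_hom_diff s_def letter_flip minus_add)
  show "letter_transvection a b (gen k) = gen k" if "k \<noteq> fst b"
  proof (cases "k = fst a")
    case True
    with assms show ?thesis
      by (auto simp: T add_hom_uminus s_def letter_def)
  next
    case False
    with that show ?thesis
      by (auto simp: T s_def letter_True)
  qed
qed

text \<open>Nielsen's theorem: an element of a coset of \<open>S\<close> minimizing the total length, and then the
  total rank of the initial halves of the images of the generators and their inverses, cannot
  shorten words, so its inverse permutes the letters.\<close>

theorem nielsen_generation:
  fixes S :: "('n::finite free_group \<Rightarrow> 'n free_group) set"
  assumes S: "S \<subseteq> auts"
    and comp: "\<And>\<sigma> \<tau>. \<sigma> \<in> S \<Longrightarrow> \<tau> \<in> S \<Longrightarrow> \<sigma> \<circ> \<tau> \<in> S"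
    and invS: "\<And>\<sigma>. \<sigma> \<in> S \<Longrightarrow> inv_into UNIV \<sigma> \<in> S"
    and signed: "\<And>s. inj (fst \<circ> s) \<Longrightarrow> signed_map s \<in> S"
    and trans: "\<And>i j. i \<noteq> j \<Longrightarrow> transvection i j \<in> S"
  shows "S = auts"
proof (rule equalityI[OF S], rule subsetI)
  fix \<sigma> :: "'n free_group \<Rightarrow> 'n free_group"
  assume \<sigma>: "\<sigma> \<in> auts"
  define size where "size = (\<lambda>\<tau> :: 'n free_group \<Rightarrow> 'n free_group. (\<Sum>i\<in>UNIV. glen (\<tau> (gen i)),
     \<Sum>i\<in>UNIV. half_rank (\<tau> (gen i)) + half_rank (- (\<tau> (gen i)))))"
  have id: "id \<in> S"
    using signed[of "\<lambda>k. (k, True)"]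
    by (simp add: signed_map_id inj_def)
  \<comment> \<open>Precomposition is the side on which transvections act as Nielsen moves on the
    tuple of images of the generators.\<close>
  define C where "C = (\<lambda>\<rho>. \<sigma> \<circ> \<rho>) ` S"
  have "wf (inv_image (less_than <*lex*> less_than) size)"
    by auto
  moreover have "\<sigma> \<in> C"
    using id by (auto simp: C_def image_iff intro!: bexI[of _ id])
  ultimately obtain \<tau> where \<tau>C: "\<tau> \<in> C"
    and min: "\<And>\<tau>'. (size \<tau>', size \<tau>) \<in> less_than <*lex*> less_than \<Longrightarrow> \<tau>' \<notin> C"
    by (rule wfE_min) (auto simp: in_inv_image)
  then obtain \<rho> where \<rho>: "\<rho> \<in> S" "\<tau> = \<sigma> \<circ> \<rho>"
    by (auto simp: C_def)
  with S \<sigma> have \<tau>: "\<tau> \<in> auts"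
    by (auto intro: comp_auts)
  have "glen g \<le> glen (\<tau> g)" for g
  proof (rule nielsen_minimal_expanding[OF \<tau>])
    fix a b :: "'n \<times> bool"
    assume ab: "fst a \<noteq> fst b"
    let ?T = "letter_transvection a b"
    show "\<not> nielsen_less (\<tau> (letter a) + \<tau> (letter b)) (\<tau> (letter b))"
    proof
      assume less: "nielsen_less (\<tau> (letter a) + \<tau> (letter b)) (\<tau> (letter b))"
      let ?\<tau> = "\<tau> \<circ> ?T"
      define s where "s = (\<lambda>k. if k = fst b then flip_letter b else if k = fst a then flip_letter a else (k, True))"
      have "inj (fst \<circ> s)"
        by (auto simp: inj_def s_def)
      then have TS: "?T \<in> S"
        using ab trans[of "fst b" "fst a"]
        by (auto simp: letter_transvection_def Let_def s_def intro!: comp signed)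
      then have "?\<tau> \<in> C"
        using comp[OF \<rho>(1) TS] by (auto simp: \<rho>(2) C_def comp_assoc)
      then have not: "(size ?\<tau>, size \<tau>) \<notin> less_than <*lex*> less_than"
        using min by blast
      have same: "?\<tau> (gen k) = \<tau> (gen k)" if "k \<noteq> fst b" for k
        using letter_transvection(2)[OF ab that] by simp
      have "?\<tau> (letter b) = \<tau> (letter a) + \<tau> (letter b)"
        using letter_transvection(1)[OF ab] auts_add[OF \<tau>] by simp
      with less have "nielsen_less (?\<tau> (letter b)) (\<tau> (letter b))" by simp
      moreover have "?\<tau> \<in> auts"
        using \<tau> TS S by (blast intro: comp_auts)
      \<comment> \<open>If \<open>b\<close> is an inverse letter, the comparison passes to the
        generator because the size is invariant under inversion.\<close>
      ultimately have "nielsen_less (?\<tau> (gen (fst b))) (\<tau> (gen (fst b)))"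
        using \<tau> by (auto simp: letter_def nielsen_less_def auts_uminus simp del: o_apply split: if_splits)
      then have "(size ?\<tau>, size \<tau>) \<in> less_than <*lex*> less_than"
        by (simp add: size_def sum.remove[of UNIV "fst b"] same nielsen_less_iff del: o_apply)
      with not show False by simp
    qed
  qed
  from expanding_is_signed_map[OF \<tau> this] obtain s where "inj (fst \<circ> s)" "inv_into UNIV \<tau> = signed_map s" .
  with signed have "inv_into UNIV (inv_into UNIV \<tau>) \<in> S"
    by (metis invS)
  then have "\<tau> \<in> S"
    by (simp add: inv_inv_eq auts_bij[OF \<tau>])
  then have "\<tau> \<circ> inv_into UNIV \<rho> \<in> S"
    by (intro comp invS \<rho>)
  moreover have "\<tau> \<circ> inv_into UNIV \<rho> = \<sigma>"
    using auts_comp_inv(1)[of \<rho>] \<rho> S by (auto simp: comp_assoc)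
  ultimately show "\<sigma> \<in> S" by simp
qed

section \<open>Coordinates on the abelianization\<close>

lemma ab_class_add: "ab_class (x + y) = ab_class x + ab_class y"
  by (simp add: ab_class_def plus_free_ab.abs_eq)

lemma add_hom_ab_class: "add_hom ab_class"
  by (simp add: add_hom_def ab_class_add)

lemmas ab_class_zero [simp] = add_hom_zero[OF add_hom_ab_class]
  and ab_class_uminus = add_hom_uminus[OF add_hom_ab_class]
  and ab_class_diff = add_hom_diff[OF add_hom_ab_class]

lemma ab_class_cases [case_names ab_class]: obtains w where "h = ab_class w"
  unfolding ab_class_def by (metis Quotient3_abs_rep Quotient3_free_ab)

lemma ab_class_eq_iff: "ab_class x = ab_class y \<longleftrightarrow> x - y \<in> derived free_grp UNIV"
  by (simp add: ab_class_def free_ab.abs_eq_iff ab_eq_def)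

lemma add_hom_derived:
  fixes f :: "'n free_group \<Rightarrow> 'b::ab_group_add"
  assumes "add_hom f" "x \<in> derived free_grp UNIV"
  shows "f x = 0"
  using assms(2) unfolding derived_def
  by (induction rule: generate.induct)
     (auto simp: add_hom_zero[OF assms(1)] add_hom_add[OF assms(1)] add_hom_uminus[OF assms(1)]
        add_hom_diff[OF assms(1)])

lemma coord_ab_class [simp]: "coord j (ab_class w) = expsum j w"
  by (simp add: ab_class_def coord.abs_eq)

lemma add_hom_expsum [simp]: "add_hom (expsum j)"
  by (simp add: add_hom_def expsum_add)

lemma expsum_gen [simp]: "expsum j (gen i) = (if i = j then 1 else 0)"
  by (simp add: gen_def expsum.abs_eq)

lemma expsum_letter: "expsum j (letter a) = (if fst a = j then if snd a then 1 else - 1 else 0)"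
  by (simp add: letter_def expsum_uminus)

lemma coord_add [simp]: "coord j (g + h) = coord j g + coord j h"
  by (cases g rule: ab_class_cases, cases h rule: ab_class_cases)
     (simp add: expsum_add flip: ab_class_add)

lemma add_hom_coord: "add_hom (coord j)"
  by (simp add: add_hom_def)

lemmas coord_zero [simp] = add_hom_zero[OF add_hom_coord]
  and coord_uminus [simp] = add_hom_uminus[OF add_hom_coord]
  and coord_diff [simp] = add_hom_diff[OF add_hom_coord]

lemma coord_sum [simp]: "coord j (sum f A) = (\<Sum>x\<in>A. coord j (f x))"
  by (induction A rule: infinite_finite_induct) auto

text \<open>A vanishing exponent sum forces the inverse of the first letter to occur later in the
  word; in the abelianization the two can be removed although they are not adjacent.\<close>

lemma ab_class_eq_0: "(\<And>j. word_expsum j w = 0) \<Longrightarrow> ab_class (abs_free_group w) = 0"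
proof (induction "length w" arbitrary: w rule: less_induct)
  case less
  show ?case
  proof (cases w)
    case (Cons a u)
    have "flip_letter a \<in> set u"
    proof (rule ccontr)
      assume *: "flip_letter a \<notin> set u"
      have "flip_letter a \<notin> set u \<Longrightarrow>
        (if snd a then word_expsum (fst a) u \<ge> 0 else word_expsum (fst a) u \<le> 0)"
        by (induction u) (auto simp: prod_eq_iff split: if_splits)
      from this[OF *] less(2)[of "fst a"] Cons show False
        by (auto split: if_splits)
    qed
    then obtain p q where u: "u = p @ flip_letter a # q"
      by (meson split_list)
    have "ab_class (abs_free_group (p @ q)) = 0"
    proof (rule less(1))
      show "word_expsum j (p @ q) = 0" for j
        using less(2)[of j] by (auto simp: Cons u word_expsum_append split: if_splits)
    qed (simp add: Cons u)
    moreover have "ab_class (abs_free_group w) = ab_class (abs_free_group (p @ q))"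
      by (simp add: Cons u abs_Cons abs_free_group_append ab_class_add letter_flip ab_class_uminus)
    ultimately show ?thesis by simp
  qed simp
qed

text \<open>H is free abelian on the generators, so equality is tested on coordinates.
  Torsion-freeness and divisibility by two in H thereby become integer arithmetic.\<close>

lemma coord_eqI: "(\<And>j. coord j g = coord j h) \<Longrightarrow> g = h"
proof -
  assume *: "\<And>j. coord j g = coord j h"
  obtain w where w: "g - h = ab_class w" by (rule ab_class_cases)
  have "word_expsum j (nf w) = 0" for j
    using *[of j] by (metis abs_nf coord_ab_class coord_diff eq_iff_diff_eq_0 expsum.abs_eq w)
  from ab_class_eq_0[OF this] w show "g = h" by simp
qed

lemma coord_surj:
  fixes z :: "'n::finite \<Rightarrow> int"
  obtains h where "\<And>j. coord j h = z j"
proof -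
  have axis: "\<exists>h. \<forall>j. coord j h = (if j = i then m else 0)" for i :: 'n and m
  proof (induction m rule: int_induct[of _ 0])
    case base
    show ?case by (rule exI[of _ 0]) simp
  next
    case (step1 m)
    then obtain h where "\<forall>j. coord j h = (if j = i then m else 0)" by blast
    then show ?case by (intro exI[of _ "h + ab_class (gen i)"]) auto
  next
    case (step2 m)
    then obtain h where "\<forall>j. coord j h = (if j = i then m else 0)" by blast
    then show ?case by (intro exI[of _ "h - ab_class (gen i)"]) auto
  qed
  define e where "e i m = (SOME h. \<forall>j. coord j h = (if j = i then m else 0))" for i :: 'n and m
  have e: "coord j (e i m) = (if j = i then m else 0)" for i j m
    using someI_ex[OF axis[of i m]] by (simp add: e_def)
  have "coord j (\<Sum>i\<in>UNIV. e i (z i)) = z j" for j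
    by (simp add: e)
  then show thesis by (rule that)
qed

lemma ab_act_ab_class [simp]:
  assumes "add_hom \<sigma>"
  shows "ab_act \<sigma> (ab_class w) = ab_class (\<sigma> w)"
proof -
  have "ab_class (\<sigma> v) = ab_class (\<sigma> w)" if "ab_class v = ab_class w" for v
  proof -
    have "(ab_class \<circ> \<sigma>) (v - w) = 0"
      using that assms
      by (intro add_hom_derived add_hom_comp add_hom_ab_class) (simp_all add: ab_class_eq_iff)
    then show ?thesis
      by (simp add: add_hom_diff[OF assms] ab_class_diff)
  qed
  then have "(\<lambda>w. ab_class (\<sigma> w)) ` {v. ab_class v = ab_class w} = {ab_class (\<sigma> w)}"
    by blast
  then show ?thesis by (simp add: ab_act_def)
qed

lemma ab_act_add: "add_hom \<sigma> \<Longrightarrow> ab_act \<sigma> (g + h) = ab_act \<sigma> g + ab_act \<sigma> h"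
  by (cases g rule: ab_class_cases, cases h rule: ab_class_cases)
     (simp add: add_hom_add flip: ab_class_add)

lemma add_hom_ab_act: "add_hom \<sigma> \<Longrightarrow> add_hom (ab_act \<sigma>)"
  by (simp add: add_hom_def[of "ab_act \<sigma>"] ab_act_add)

lemmas ab_act_zero = add_hom_zero[OF add_hom_ab_act]
  and ab_act_diff = add_hom_diff[OF add_hom_ab_act]

lemma ab_act_comp: "add_hom \<sigma> \<Longrightarrow> add_hom \<tau> \<Longrightarrow> ab_act (\<tau> \<circ> \<sigma>) h = ab_act \<tau> (ab_act \<sigma> h)"
  by (cases h rule: ab_class_cases) (simp add: add_hom_comp)

lemma ab_act_id [simp]: "ab_act id h = h"
  by (cases h rule: ab_class_cases) (simp add: add_hom_def)

lemma coord_ab_act: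
  fixes h :: "'n::finite free_ab"
  assumes "add_hom \<sigma>"
  shows "coord j (ab_act \<sigma> h) = (\<Sum>i\<in>UNIV. coord i h * coord j (ab_act \<sigma> (ab_class (gen i))))"
proof (cases h rule: ab_class_cases)
  case (ab_class w)
  have "expsum j \<circ> \<sigma> = (\<lambda>w. \<Sum>i\<in>UNIV. expsum i w * expsum j (\<sigma> (gen i)))"
  proof (rule add_hom_eqI)
    show "add_hom (\<lambda>w. \<Sum>i\<in>UNIV. expsum i w * expsum j (\<sigma> (gen i)))"
      by (simp add: add_hom_def expsum_add distrib_right sum.distrib)
    show "(expsum j \<circ> \<sigma>) (gen i) = (\<Sum>k\<in>UNIV. expsum k (gen i) * expsum j (\<sigma> (gen k)))" for i
      proof -
      have "expsum k (gen i) * expsum j (\<sigma> (gen k)) = (if i = k then expsum j (\<sigma> (gen k)) else 0)" for k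
        by simp
      then show ?thesis by (simp only: sum.delta finite) simp
    qed
  qed (simp_all add: assms add_hom_comp)
  from fun_cong[OF this, of w] show ?thesis
    by (simp add: ab_class assms)
qed

section \<open>The Magnus representation and its determinant\<close>

lemma poly_mapping_sum_single:
  fixes p :: "'a \<Rightarrow>\<^sub>0 'b::comm_monoid_add"
  shows "p = (\<Sum>k\<in>Poly_Mapping.keys p. Poly_Mapping.single k (Poly_Mapping.lookup p k))"
proof (rule poly_mapping_eqI)
  fix x
  show "Poly_Mapping.lookup p x =
    Poly_Mapping.lookup (\<Sum>k\<in>Poly_Mapping.keys p. Poly_Mapping.single k (Poly_Mapping.lookup p k)) x"
    by (auto simp: lookup_sum lookup_single when_def in_keys_iff)
qed

lemma poly_mapping_add_induct [case_names zero single add]: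
  fixes p :: "'a \<Rightarrow>\<^sub>0 'b::comm_monoid_add"
  assumes "P 0" "\<And>k c. P (Poly_Mapping.single k c)" "\<And>p q. P p \<Longrightarrow> P q \<Longrightarrow> P (p + q)"
  shows "P p"
proof -
  have "P (\<Sum>k\<in>A. Poly_Mapping.single k (Poly_Mapping.lookup p k))" for A
    by (induction A rule: infinite_finite_induct) (auto intro: assms)
  then show ?thesis by (subst poly_mapping_sum_single)
qed

lemma Z_linear_extension_superset:
  assumes "finite A" "Poly_Mapping.keys p \<subseteq> A"
  shows "Z_linear_extension f p = (\<Sum>g\<in>A. of_int (Poly_Mapping.lookup p g) * f g)"
  unfolding Z_linear_extension_def
  by (rule sum.mono_neutral_left) (use assms in \<open>auto simp: in_keys_iff\<close>)

lemma Z_linear_extension_add: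
  "Z_linear_extension f (p + q) = Z_linear_extension f p + Z_linear_extension f q"
proof -
  let ?A = "Poly_Mapping.keys p \<union> Poly_Mapping.keys q"
  have "Poly_Mapping.keys (p + q) \<subseteq> ?A" by (rule Poly_Mapping.keys_add)
  then show ?thesis
    by (subst (1 2 3) Z_linear_extension_superset[where A = ?A])
       (auto simp: lookup_add distrib_right sum.distrib)
qed

lemma add_hom_Z_linear_extension: "add_hom (Z_linear_extension f)"
  by (simp add: add_hom_def Z_linear_extension_add)

lemmas Z_linear_extension_zero [simp] = add_hom_zero[OF add_hom_Z_linear_extension]
  and Z_linear_extension_uminus = add_hom_uminus[OF add_hom_Z_linear_extension]

lemma Z_linear_extension_single [simp]:
  "Z_linear_extension f (Poly_Mapping.single g n) = of_int n * f g"
  by (simp add: Z_linear_extension_def)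

lemma Z_linear_extension_mult:
  fixes f :: "'g::monoid_add \<Rightarrow> 'r::ring_1"
  assumes "\<And>x y. f (x + y) = f x * f y"
  shows "Z_linear_extension f (p * q) = Z_linear_extension f p * Z_linear_extension f q"
proof (induction p rule: poly_mapping_add_induct)
  case (single x m)
  show ?case
  proof (induction q rule: poly_mapping_add_induct)
    case (single y n)
    have "of_int (m * n) * f (x + y) = (of_int m * f x) * (of_int n * f y)"
      unfolding assms by (metis mult.assoc mult_of_int_commute of_int_mult)
    then show ?case by (simp only: mult_single Z_linear_extension_single)
  qed (simp_all add: distrib_left Z_linear_extension_add)
qed (simp_all add: distrib_right Z_linear_extension_add)

lemma Z_linear_extension_one: "f 0 = 1 \<Longrightarrow> Z_linear_extension f 1 = 1"
  unfolding single_one[symmetric] by (simp del: single_one)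

abbreviation ring_elem :: "'g \<Rightarrow> ('g \<Rightarrow>\<^sub>0 int)" where
  "ring_elem g \<equiv> Poly_Mapping.single g 1"

lemma ring_elem_add: "ring_elem (x + y) = ring_elem x * ring_elem y" for x y :: "'g::monoid_add"
  by (simp add: mult_single)

lemma ring_elem_inject: "ring_elem x = ring_elem y \<longleftrightarrow> x = y"
  by (metis keys_single singleton_inject zero_neq_one)

lemma ring_elem_sum:
  "finite A \<Longrightarrow> ring_elem (\<Sum>i\<in>A. f i) = (\<Prod>i\<in>A. ring_elem (f i :: 'g::comm_monoid_add))"
  by (induction A rule: finite_induct) (simp_all add: ring_elem_add)

lemma abelianize_simps:
  "abelianize (p + q) = abelianize p + abelianize q"
  "abelianize (p * q) = abelianize p * abelianize q"
  "abelianize 0 = 0" "abelianize 1 = 1"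
  "abelianize (ring_elem w) = ring_elem (ab_class w)"
  by (simp_all add: abelianize_def Z_linear_extension_add Z_linear_extension_mult ab_class_add
        ring_elem_add Z_linear_extension_one)

section \<open>Abelianized Fox derivatives and the chain rule\<close>

definition fox_ab :: "'n \<Rightarrow> 'n free_group \<Rightarrow> ('n free_ab \<Rightarrow>\<^sub>0 int)" where
  "fox_ab j w = abelianize (fox_elem j w)"

lemma fox_ab_add: "fox_ab j (x + y) = fox_ab j x + ring_elem (ab_class x) * fox_ab j y"
  by (simp add: fox_ab_def fox_elem_add abelianize_simps)

lemma fox_ab_gen [simp]: "fox_ab j (gen i) = (if i = j then 1 else 0)"
  by (simp add: fox_ab_def fox_elem_gen abelianize_simps)

lemma magnus_nth: "magnus \<sigma> $ i $ j = fox_ab j (\<sigma> (gen i))"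
  by (simp add: magnus_def fox_ab_def fox_def)

text \<open>These are derivations twisted by \<open>\<mu>\<close>. They are determined by their
  values on generators, so identities of Fox calculus reduce to a check there.\<close>

definition ring_cocycle :: "('g::group_add \<Rightarrow> 'r::ring_1) \<Rightarrow> ('g \<Rightarrow> 'r) \<Rightarrow> bool" where
  "ring_cocycle \<mu> c \<longleftrightarrow> \<mu> 0 = 1 \<and> (\<forall>x y. c (x + y) = c x + \<mu> x * c y)"

lemma ring_cocycle_add: "ring_cocycle \<mu> c \<Longrightarrow> c (x + y) = c x + \<mu> x * c y"
  by (simp add: ring_cocycle_def)

lemma ring_cocycle_zero: "ring_cocycle \<mu> c \<Longrightarrow> c 0 = 0"
  unfolding ring_cocycle_def by (metis add_0 add_cancel_right_right mult_1)

lemma ring_cocycle_uminus: "ring_cocycle \<mu> c \<Longrightarrow> c (- x) = - \<mu> (- x) * c x"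
  using ring_cocycle_add[of \<mu> c "- x" x] by (simp add: ring_cocycle_zero eq_neg_iff_add_eq_0)

lemma ring_cocycle_eqI:
  assumes "ring_cocycle \<mu> c" "ring_cocycle \<mu> d" "\<And>i. c (gen i) = d (gen i)"
  shows "c w = d w"
proof (induction w rule: free_group_induct)
  case (letter a g)
  have "c (letter a) = d (letter a)"
    by (simp add: letter_def assms(3) assms(1,2)[THEN ring_cocycle_uminus])
  then show ?case
    using letter by (simp add: assms(1,2)[THEN ring_cocycle_add])
qed (simp add: assms(1,2)[THEN ring_cocycle_zero])

lemma ring_cocycle_fox_ab: "ring_cocycle (\<lambda>w. ring_elem (ab_class w)) (fox_ab j)"
  by (simp add: ring_cocycle_def fox_ab_add)

definition ring_act :: "('n free_group \<Rightarrow> 'n free_group) \<Rightarrow> ('n free_ab \<Rightarrow>\<^sub>0 int) \<Rightarrow> ('n free_ab \<Rightarrow>\<^sub>0 int)" where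
  "ring_act \<sigma> = Z_linear_extension (\<lambda>h. ring_elem (ab_act \<sigma> h))"

lemma ring_act_simps:
  assumes "add_hom \<sigma>"
  shows "ring_act \<sigma> (p + q) = ring_act \<sigma> p + ring_act \<sigma> q"
    "ring_act \<sigma> (p * q) = ring_act \<sigma> p * ring_act \<sigma> q"
    "ring_act \<sigma> 0 = 0" "ring_act \<sigma> 1 = 1"
    "ring_act \<sigma> (ring_elem h) = ring_elem (ab_act \<sigma> h)"
    "ring_act \<sigma> (- p) = - ring_act \<sigma> p"
  by (simp_all add: ring_act_def Z_linear_extension_add Z_linear_extension_mult ab_act_add assms
        ring_elem_add Z_linear_extension_one ab_act_zero Z_linear_extension_uminus)

lemma ring_act_of_int: "add_hom \<sigma> \<Longrightarrow> ring_act \<sigma> (of_int n) = of_int n"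
  by (induction n rule: int_induct[of _ 0]) (auto simp: ring_act_simps diff_conv_add_uminus simp del: add_uminus_conv_diff)

lemma ring_act_sum: "add_hom \<sigma> \<Longrightarrow> ring_act \<sigma> (sum f A) = (\<Sum>x\<in>A. ring_act \<sigma> (f x))"
  by (induction A rule: infinite_finite_induct) (auto simp: ring_act_simps)

lemma ring_act_prod: "add_hom \<sigma> \<Longrightarrow> ring_act \<sigma> (prod f A) = (\<Prod>x\<in>A. ring_act \<sigma> (f x))"
  by (induction A rule: infinite_finite_induct) (auto simp: ring_act_simps)

lemma ring_act_det:
  "add_hom \<sigma> \<Longrightarrow> ring_act \<sigma> (det A) = det (\<chi> i j. ring_act \<sigma> (A $ i $ j))"
  by (simp add: det_def ring_act_sum ring_act_prod ring_act_simps(2) ring_act_of_int)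

text \<open>Both sides are derivations in \<open>w\<close>, twisted by the class of
  \<open>\<tau> w\<close>, and they agree on generators because the derivatives of a generator form
  a row of the identity matrix.\<close>

lemma fox_chain_rule:
  fixes \<tau> :: "'n::finite free_group \<Rightarrow> 'n free_group"
  assumes "add_hom \<tau>"
  shows "fox_ab j (\<tau> w) = (\<Sum>l\<in>UNIV. ring_act \<tau> (fox_ab l w) * fox_ab j (\<tau> (gen l)))"
proof (rule ring_cocycle_eqI[where \<mu> = "\<lambda>w. ring_elem (ab_class (\<tau> w))"])
  show "ring_cocycle (\<lambda>w. ring_elem (ab_class (\<tau> w))) (\<lambda>w. fox_ab j (\<tau> w))"
    using assms by (simp add: ring_cocycle_def add_hom_add add_hom_zero fox_ab_add)
  show "ring_cocycle (\<lambda>w. ring_elem (ab_class (\<tau> w)))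
     (\<lambda>w. \<Sum>l\<in>UNIV. ring_act \<tau> (fox_ab l w) * fox_ab j (\<tau> (gen l)))"
    using assms
    by (simp add: ring_cocycle_def add_hom_zero fox_ab_add ring_act_simps distrib_right sum.distrib
          sum_distrib_left mult.assoc)
  show "fox_ab j (\<tau> (gen i)) = (\<Sum>l\<in>UNIV. ring_act \<tau> (fox_ab l (gen i)) * fox_ab j (\<tau> (gen l)))" for i
  proof -
    have "ring_act \<tau> (fox_ab l (gen i)) * fox_ab j (\<tau> (gen l)) = (if i = l then fox_ab j (\<tau> (gen l)) else 0)" for l
      using assms by (simp add: ring_act_simps)
    then show ?thesis by simp
  qed
qed

text \<open>In the right-action convention \<open>\<tau> \<circ> \<sigma>\<close> is the product
  \<sigma>\<tau>, so this is the crossed-homomorphism law of the Magnus representation in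
  multiplicative form; determinants inherit it because Z[H] is commutative.\<close>

lemma magnus_comp:
  assumes "add_hom \<tau>"
  shows "magnus (\<tau> \<circ> \<sigma>) = (\<chi> i j. ring_act \<tau> (magnus \<sigma> $ i $ j)) ** magnus \<tau>"
  by (simp add: vec_eq_iff matrix_matrix_mult_def magnus_nth fox_chain_rule[OF assms, of _ "\<sigma> _"])

lemma det_magnus_comp:
  "add_hom \<tau> \<Longrightarrow> det (magnus (\<tau> \<circ> \<sigma>)) = ring_act \<tau> (det (magnus \<sigma>)) * det (magnus \<tau>)"
  by (simp add: magnus_comp det_mul ring_act_det)

lemma det_sgn_comp:
  assumes "add_hom \<sigma>" "add_hom \<tau>"
  shows "det_sgn (\<tau> \<circ> \<sigma>) = det_sgn \<sigma> * det_sgn \<tau>"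
proof -
  have "(\<chi> i j. coord j (ab_act (\<tau> \<circ> \<sigma>) (ab_class (gen i)))) =
      (\<chi> i j. coord j (ab_act \<sigma> (ab_class (gen i)))) ** (\<chi> i j. coord j (ab_act \<tau> (ab_class (gen i))))"
    by (simp add: vec_eq_iff matrix_matrix_mult_def ab_act_comp[OF assms] coord_ab_act[OF assms(2), of _ "ab_act \<sigma> _"]
         del: ab_act_ab_class)
  then show ?thesis by (simp add: det_sgn_def det_mul)
qed

lemma det_monomial:
  fixes c :: "'n::finite \<Rightarrow> 'a::comm_ring_1"
  assumes "p permutes UNIV"
  shows "det (\<chi> i j. if j = p i then c i else 0) = of_int (sign p) * (\<Prod>i\<in>UNIV. c i)"
proof -
  let ?q = "inv_into UNIV p"
  have q: "?q permutes UNIV"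
    by (rule permutes_inv[OF assms])
  have "(\<chi> i j. if j = p i then c i else 0) = (\<chi> i j. (\<chi> i j. if i = j then c i else 0) $ i $ ?q j)"
    using assms by (auto simp: vec_eq_iff permutes_inverses)
  then have "det (\<chi> i j. if j = p i then c i else 0) =
      of_int (sign ?q) * det (\<chi> i j. if i = j then c i else 0)"
    by (simp only: det_permute_columns[OF q])
  also have "sign ?q = sign p"
    using assms by (intro sign_inverse) (auto simp: permutation_permutes)
  also have "det (\<chi> i j. if i = j then c i else 0) = (\<Prod>i\<in>UNIV. c i)"
    by (subst det_diagonal) auto
  finally show ?thesis .
qed

section \<open>The signed determinant takes values in H\<close>

definition signed_det :: "('n::finite free_group \<Rightarrow> 'n free_group) \<Rightarrow> ('n free_ab \<Rightarrow>\<^sub>0 int)" where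
  "signed_det \<sigma> = of_int (det_sgn \<sigma>) * det (magnus \<sigma>)"

lemma signed_det_comp:
  "add_hom \<sigma> \<Longrightarrow> add_hom \<tau> \<Longrightarrow> signed_det (\<tau> \<circ> \<sigma>) = ring_act \<tau> (signed_det \<sigma>) * signed_det \<tau>"
  by (simp add: signed_det_def det_sgn_comp det_magnus_comp ring_act_simps ring_act_of_int algebra_simps)

lemma fox_ab_letter:
  "fox_ab j (letter a) = (if j = fst a then if snd a then 1 else - ring_elem (ab_class (letter a)) else 0)"
  by (simp add: letter_def ring_cocycle_uminus[OF ring_cocycle_fox_ab])

text \<open>Both matrices are monomial with the same permutation, whose sign occurs twice and
  cancels. The signs in the derivatives of inverted generators cancel against those of the action on
  H, leaving a product of group elements.\<close>

lemma signed_det_signed_map: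
  fixes s :: "'n::finite \<Rightarrow> 'n \<times> bool"
  assumes "inj (fst \<circ> s)"
  shows "signed_det (signed_map s) = ring_elem (\<Sum>i\<in>UNIV. if snd (s i) then 0 else ab_class (letter (s i)))"
proof -
  have "bij (fst \<circ> s)"
    using assms finite_UNIV_inj_surj[OF finite assms] by (auto simp: bij_def)
  then have perm: "(fst \<circ> s) permutes UNIV"
    by (rule bij_imp_permutes) simp
  let ?c = "\<lambda>i. if snd (s i) then 1 else - ring_elem (ab_class (letter (s i)))"
  let ?e = "\<lambda>i. if snd (s i) then 1 else - 1 :: int"
  have "magnus (signed_map s) = (\<chi> i j. if j = (fst \<circ> s) i then ?c i else 0)"
    by (auto simp: vec_eq_iff magnus_nth fox_ab_letter)
  then have 1: "det (magnus (signed_map s)) = of_int (sign (fst \<circ> s)) * (\<Prod>i\<in>UNIV. ?c i)"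
    by (simp only: det_monomial[OF perm])
  have "(\<chi> i j. coord j (ab_act (signed_map s) (ab_class (gen i)))) =
      (\<chi> i j. if j = (fst \<circ> s) i then ?e i else 0)"
    by (auto simp: vec_eq_iff expsum_letter)
  then have 2: "det_sgn (signed_map s) = of_int (sign (fst \<circ> s)) * (\<Prod>i\<in>UNIV. ?e i)"
    unfolding det_sgn_def by (simp only: det_monomial[OF perm])
  have "signed_det (signed_map s) =
      of_int (sign (fst \<circ> s) * sign (fst \<circ> s)) * ((\<Prod>i\<in>UNIV. of_int (?e i)) * (\<Prod>i\<in>UNIV. ?c i))"
    by (simp only: signed_det_def 1 2 of_int_mult of_int_prod of_int_eq_id id_apply mult_ac)
  also have "\<dots> = (\<Prod>i\<in>UNIV. of_int (?e i) * ?c i)"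
    by (simp only: sign_idempotent of_int_1 mult_1 prod.distrib)
  also have "\<dots> = (\<Prod>i\<in>UNIV. ring_elem (if snd (s i) then 0 else ab_class (letter (s i))))"
    by (auto intro!: prod.cong)
  also have "\<dots> = ring_elem (\<Sum>i\<in>UNIV. if snd (s i) then 0 else ab_class (letter (s i)))"
    by (rule ring_elem_sum[symmetric]) simp
  finally show ?thesis .
qed

lemma det_elementary:
  fixes c :: "'a::comm_ring_1" and i j :: "'n::finite"
  assumes "i \<noteq> j"
  shows "det (\<chi> k l. if k = i then (if l = i then 1 else 0) + (if l = j then c else 0)
     else if l = k then 1 else 0) = 1"
proof -
  have "(\<chi> k l. if k = i then (if l = i then 1 else 0) + (if l = j then c else 0)
     else if l = k then 1 else 0) =
     (\<chi> k. if k = i then row i (mat 1) + c *s row j (mat 1) else row k (mat 1))"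
    by (auto simp: vec_eq_iff row_def mat_def)
  then show ?thesis
    by (simp add: det_row_operation[OF assms])
qed

lemma signed_det_transvection:
  assumes "i \<noteq> j"
  shows "signed_det (transvection i j :: 'n::finite free_group \<Rightarrow> 'n free_group) = 1"
proof -
  have 1: "magnus (transvection i j) = (\<chi> k l. if k = i then (if l = i then 1 else 0)
      + (if l = j then ring_elem (ab_class (gen i)) else 0) else if l = k then 1 else 0)"
    by (auto simp: vec_eq_iff magnus_nth fox_ab_add)
  have 2: "(\<chi> k l. coord l (ab_act (transvection i j) (ab_class (gen k)))) =
      (\<chi> k l. if k = i then (if l = i then 1 else 0)
      + (if l = j then 1 else 0) else if l = k then 1 else 0)"
    by (auto simp: vec_eq_iff expsum_add)
  show ?thesis
    by (simp only: signed_det_def det_sgn_def 1 2 det_elementary[OF assms]) simp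
qed

text \<open>The property is inherited by products and inverses, so it has to be checked only on
  Nielsen's generators. It is what gives the definite description in \<open>morita\<close> a
  value.\<close>

lemma signed_det_group_element:
  fixes \<sigma> :: "'n::finite free_group \<Rightarrow> 'n free_group"
  assumes "\<sigma> \<in> auts"
  shows "\<exists>h. signed_det \<sigma> = ring_elem h"
proof -
  let ?S = "{\<sigma> \<in> auts. \<exists>h. signed_det \<sigma> = ring_elem h} :: ('n free_group \<Rightarrow> 'n free_group) set"
  have comp: "\<tau> \<circ> \<sigma> \<in> ?S" if "\<sigma> \<in> ?S" "\<tau> \<in> ?S" for \<sigma> \<tau>
    using that by (auto simp: signed_det_comp auts_add_hom comp_auts ring_act_simps simp flip: ring_elem_add)
  have signed: "signed_map s \<in> ?S" if "inj (fst \<circ> s)" for s :: "'n \<Rightarrow> 'n \<times> bool"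
    using that signed_map_auts signed_det_signed_map by blast
  have trans: "transvection i j \<in> ?S" if "i \<noteq> j" for i j :: 'n
    using transvection_auts[OF that] signed_det_transvection[OF that] by (auto intro!: exI[of _ 0])
  have inv: "inv_into UNIV \<sigma> \<in> ?S" if "\<sigma> \<in> ?S" for \<sigma>
  proof -
    from that obtain h where \<sigma>: "\<sigma> \<in> auts" and h: "signed_det \<sigma> = ring_elem h" by blast
    let ?\<tau> = "inv_into UNIV \<sigma>"
    have \<tau>: "?\<tau> \<in> auts" by (rule inv_auts[OF \<sigma>])
    \<comment> \<open>The identity counts as the signed permutation without inverted generators, for
      which all summands of the exponent vanish.\<close>
    have "signed_det (?\<tau> \<circ> \<sigma>) = 1"
      unfolding auts_comp_inv(2)[OF \<sigma>] signed_map_id[symmetric] by (subst signed_det_signed_map) (auto simp: inj_def)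
    then have "ring_elem (ab_act ?\<tau> h) * signed_det ?\<tau> = 1"
      using \<sigma> \<tau> by (simp add: signed_det_comp auts_add_hom h ring_act_simps)
    then have "ring_elem (- ab_act ?\<tau> h) * (ring_elem (ab_act ?\<tau> h) * signed_det ?\<tau>) = ring_elem (- ab_act ?\<tau> h)"
      by simp
    then have "signed_det ?\<tau> = ring_elem (- ab_act ?\<tau> h)"
      by (simp add: mult.assoc[symmetric] flip: ring_elem_add)
    with \<tau> show ?thesis by blast
  qed
  have "?S = auts"
    by (rule nielsen_generation) (use comp inv signed trans in auto)
  with assms show ?thesis by blast
qed

lemma morita_eqI: "signed_det \<sigma> = ring_elem h \<Longrightarrow> morita \<sigma> = h"
  unfolding morita_def signed_det_def[symmetric] by (auto simp: ring_elem_inject)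

lemma ring_elem_morita: "\<sigma> \<in> auts \<Longrightarrow> ring_elem (morita \<sigma>) = signed_det \<sigma>"
  using signed_det_group_element morita_eqI by metis

lemma morita_comp:
  "\<sigma> \<in> auts \<Longrightarrow> \<tau> \<in> auts \<Longrightarrow> morita (\<tau> \<circ> \<sigma>) = ab_act \<tau> (morita \<sigma>) + morita \<tau>"
  by (rule morita_eqI)
     (simp add: signed_det_comp auts_add_hom ring_elem_add ring_act_simps flip: ring_elem_morita)

lemma morita_transvection: "i \<noteq> j \<Longrightarrow> morita (transvection i j) = 0"
  by (rule morita_eqI) (simp add: signed_det_transvection)

lemma morita_signed_map:
  "inj (fst \<circ> s) \<Longrightarrow> morita (signed_map s) = (\<Sum>i\<in>UNIV. if snd (s i) then 0 else ab_class (letter (s i)))"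
  by (rule morita_eqI, rule signed_det_signed_map)

section \<open>Crossed homomorphisms on the automorphism group\<close>

text \<open>The order \<open>\<tau> \<circ> \<sigma>\<close> is the product \<sigma>\<tau> of the
  right action, written with ordinary composition.\<close>

definition crossed :: "(('n free_group \<Rightarrow> 'n free_group) \<Rightarrow> 'n free_ab) \<Rightarrow> bool" where
  "crossed f \<longleftrightarrow> (\<forall>\<sigma>\<in>auts. \<forall>\<tau>\<in>auts. f (\<tau> \<circ> \<sigma>) = ab_act \<tau> (f \<sigma>) + f \<tau>)"

lemma crossedD: "crossed f \<Longrightarrow> \<sigma> \<in> auts \<Longrightarrow> \<tau> \<in> auts \<Longrightarrow> f (\<tau> \<circ> \<sigma>) = ab_act \<tau> (f \<sigma>) + f \<tau>"
  by (simp add: crossed_def)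

lemma crossed_id: "crossed f \<Longrightarrow> f id = 0"
  using crossedD[of f id id] by (simp add: id_auts)

lemma crossed_zero: "crossed (\<lambda>_. 0)"
  by (simp add: crossed_def ab_act_zero auts_add_hom)

lemma crossed_add: "crossed f \<Longrightarrow> crossed g \<Longrightarrow> crossed (\<lambda>\<sigma>. f \<sigma> + g \<sigma>)"
  by (simp add: crossed_def ab_act_add auts_add_hom algebra_simps)

lemma crossed_principal: "crossed (\<lambda>\<sigma>. ab_act \<sigma> h - h)"
  by (simp add: crossed_def ab_act_comp ab_act_diff auts_add_hom)

lemma crossed_morita: "crossed morita"
  by (simp add: crossed_def morita_comp)

text \<open>The automorphisms on which two crossed homomorphisms agree form a subgroup, so Nielsen's
  generators decide.\<close>

lemma crossed_eqI:
  fixes f g :: "('n::finite free_group \<Rightarrow> 'n free_group) \<Rightarrow> 'n free_ab"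
  assumes "crossed f" "crossed g"
    and signed: "\<And>s. inj (fst \<circ> s) \<Longrightarrow> f (signed_map s) = g (signed_map s)"
    and trans: "\<And>i j. i \<noteq> j \<Longrightarrow> f (transvection i j) = g (transvection i j)"
    and "\<sigma> \<in> auts"
  shows "f \<sigma> = g \<sigma>"
proof -
  have "{\<sigma> \<in> auts. f \<sigma> = g \<sigma>} = auts"
  proof (rule nielsen_generation)
    fix \<sigma> assume "\<sigma> \<in> {\<sigma> \<in> auts. f \<sigma> = g \<sigma>}"
    then have \<sigma>: "\<sigma> \<in> auts" "f \<sigma> = g \<sigma>" by auto
    let ?\<tau> = "inv_into UNIV \<sigma>"
    have "ab_act ?\<tau> (f \<sigma>) + f ?\<tau> = 0" "ab_act ?\<tau> (g \<sigma>) + g ?\<tau> = 0"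
      using assms(1,2)[THEN crossedD, OF \<sigma>(1) inv_auts[OF \<sigma>(1)]] \<sigma>(1)
      by (simp_all add: auts_comp_inv assms(1,2)[THEN crossed_id])
    then have "f ?\<tau> = g ?\<tau>"
      using \<sigma>(2) by (metis add_left_cancel)
    with \<sigma>(1) show "?\<tau> \<in> {\<sigma> \<in> auts. f \<sigma> = g \<sigma>}"
      by (simp add: inv_auts)
  qed (auto simp: assms comp_auts crossedD signed_map_auts transvection_auts)
  with \<open>\<sigma> \<in> auts\<close> show ?thesis by blast
qed

text \<open>The multiple of \<open>h\<close> by \<open>m\<close>, selected through its coordinates,
  which determine it; all its properties can then be checked coordinatewise.\<close>

definition int_scale :: "int \<Rightarrow> 'n::finite free_ab \<Rightarrow> 'n free_ab" where
  "int_scale m h = (SOME g. \<forall>j. coord j g = m * coord j h)"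

lemma coord_int_scale [simp]: "coord j (int_scale m h) = m * coord j h"
proof -
  obtain g where "\<And>j. coord j g = m * coord j h"
    by (rule coord_surj[of "\<lambda>j. m * coord j h"]) blast
  then have "\<exists>g. \<forall>j. coord j g = m * coord j h" by blast
  from someI_ex[OF this] show ?thesis by (simp add: int_scale_def)
qed

lemma ab_act_int_scale: "add_hom \<sigma> \<Longrightarrow> ab_act \<sigma> (int_scale m h) = int_scale m (ab_act \<sigma> h)"
  by (rule coord_eqI) (simp add: coord_ab_act sum_distrib_left mult.assoc)

lemma crossed_int_scale: "crossed f \<Longrightarrow> crossed (\<lambda>\<sigma>. int_scale m (f \<sigma>))"
  unfolding crossed_def
  by (auto simp: ab_act_int_scale auts_add_hom distrib_left intro!: coord_eqI)

lemma coord_ab_act_signed_map: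
  assumes "inj (fst \<circ> s)"
  shows "coord (fst (s i)) (ab_act (signed_map s) h) = (if snd (s i) then coord i h else - coord i h)"
proof (cases h rule: ab_class_cases)
  case (ab_class w)
  have "expsum (fst (s i)) \<circ> signed_map s = (\<lambda>w. if snd (s i) then expsum i w else - expsum i w)"
  proof (rule add_hom_eqI)
    show "add_hom (\<lambda>w. if snd (s i) then expsum i w else - expsum i w)"
      by (simp add: add_hom_def expsum_add)
    show "(expsum (fst (s i)) \<circ> signed_map s) (gen k) = (if snd (s i) then expsum i (gen k) else - expsum i (gen k))" for k
      using inj_eq[OF assms, of k i] by (auto simp: expsum_letter)
  qed (simp add: add_hom_comp)
  from fun_cong[OF this, of w] show ?thesis by (simp add: ab_class)
qed

lemma coord_ab_act_transvection:
  "coord l (ab_act (transvection i j) h) = coord l h + (if l = j then coord i h else 0)"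
proof (cases h rule: ab_class_cases)
  case (ab_class w)
  have "expsum l \<circ> transvection i j = (\<lambda>w. expsum l w + (if l = j then expsum i w else 0))"
  proof (rule add_hom_eqI)
    show "add_hom (\<lambda>w. expsum l w + (if l = j then expsum i w else 0))"
      by (simp add: add_hom_def expsum_add)
  qed (auto simp: add_hom_comp expsum_add)
  from fun_cong[OF this, of w] show ?thesis by (simp add: ab_class)
qed

section \<open>Cocycles on signed permutations\<close>

definition invert_all :: "'n free_group \<Rightarrow> 'n free_group" where
  "invert_all = signed_map (\<lambda>i. (i, False))"

definition invert_gen :: "'n \<Rightarrow> 'n free_group \<Rightarrow> 'n free_group" where
  "invert_gen k = signed_map (\<lambda>i. (i, i \<noteq> k))"

lemma invert_auts [simp]:
  "invert_all \<in> (auts :: ('n::finite free_group \<Rightarrow> 'n free_group) set)"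
  "invert_gen k \<in> (auts :: ('n::finite free_group \<Rightarrow> 'n free_group) set)"
  unfolding invert_all_def invert_gen_def by (auto intro!: signed_map_auts simp: inj_def)

lemma coord_ab_act_invert:
  "coord i (ab_act invert_all h) = - coord i h"
  "coord i (ab_act (invert_gen k) h) = (if i = k then - coord i h else coord i h)"
  using coord_ab_act_signed_map[of "\<lambda>i. (i, False)" i h]
    coord_ab_act_signed_map[of "\<lambda>i. (i, i \<noteq> k)" i h]
  by (auto simp: invert_all_def invert_gen_def inj_def)

lemma ab_act_invert_all: "ab_act invert_all h = - h"
  by (rule coord_eqI) (simp add: coord_ab_act_invert)

lemma invert_all_gen [simp]: "invert_all (gen i) = - gen i"
  by (simp add: invert_all_def letter_def)

lemma invert_gen_gen [simp]: "invert_gen k (gen i) = (if i = k then - gen i else gen i)"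
  by (simp add: invert_gen_def letter_def)

lemma add_hom_invert [simp]: "add_hom invert_all" "add_hom (invert_gen k)"
  by (simp_all add: invert_all_def invert_gen_def)

lemma invert_all_commute: "signed_map s \<circ> invert_all = invert_all \<circ> signed_map s"
  by (rule add_hom_eqI) (auto simp: add_hom_comp letter_def add_hom_uminus)

lemma coord_morita_invert_all: "coord j (morita (invert_all :: 'n::finite free_group \<Rightarrow> 'n free_group)) = - 1"
  unfolding invert_all_def by (simp add: morita_signed_map inj_def expsum_letter)

text \<open>The value on the product with \<open>invert_all\<close> is computed in both orders;
  since \<open>invert_all\<close> acts by negation, the two copies of
  \<open>f (signed_map s)\<close> add up instead of cancelling.\<close>

lemma crossed_signed_map:
  fixes f :: "('n::finite free_group \<Rightarrow> 'n free_group) \<Rightarrow> 'n free_ab"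
  assumes "crossed f" "inj (fst \<circ> s)"
  shows "f (signed_map s) + f (signed_map s) = f invert_all - ab_act (signed_map s) (f invert_all)"
proof -
  have s: "signed_map s \<in> auts" by (rule signed_map_auts[OF assms(2)])
  have "ab_act (signed_map s) (f invert_all) + f (signed_map s) = f (signed_map s \<circ> invert_all)"
    using crossedD[OF assms(1) _ s] by simp
  also have "\<dots> = f invert_all - f (signed_map s)"
    using crossedD[OF assms(1) s, of invert_all] by (simp add: invert_all_commute ab_act_invert_all)
  finally show ?thesis by (simp add: algebra_simps)
qed

text \<open>For the transposition of \<open>i\<close> and \<open>j\<close>, coordinate
  \<open>i\<close> of \<open>crossed_signed_map\<close> has twice an integer on the left and the
  difference in question on the right.\<close>

lemma crossed_invert_all_parity:
  fixes f :: "('n::finite free_group \<Rightarrow> 'n free_group) \<Rightarrow> 'n free_ab"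
  assumes "crossed f"
  shows "even (coord i (f invert_all) - coord j (f invert_all))"
proof -
  let ?s = "\<lambda>k. (Transposition.transpose i j k, True)"
  have inj: "inj (fst \<circ> ?s)" by (simp add: comp_def)
  have "coord i (f (signed_map ?s) + f (signed_map ?s)) = coord i (f invert_all) - coord j (f invert_all)"
    using coord_ab_act_signed_map[OF inj, of j]
    by (simp add: crossed_signed_map[OF assms inj] del: coord_add)
  then show ?thesis by (metis coord_add even_add)
qed

lemma crossed_signed_map_0:
  fixes f :: "('n::finite free_group \<Rightarrow> 'n free_group) \<Rightarrow> 'n free_ab"
  assumes "crossed f" "f invert_all = 0" "inj (fst \<circ> s)"
  shows "f (signed_map s) = 0"
proof (rule coord_eqI)
  fix j
  have "f (signed_map s) + f (signed_map s) = 0"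
    by (simp add: crossed_signed_map[OF assms(1,3)] assms(2) ab_act_zero)
  then have "coord j (f (signed_map s) + f (signed_map s)) = 0" by simp
  then show "coord j (f (signed_map s)) = coord j 0" by simp
qed

text \<open>Double transitivity of the symmetric group, used to carry any transvection to any
  other.\<close>

lemma ex_permutation_two_points:
  fixes i j k l :: 'a
  assumes "i \<noteq> j" "k \<noteq> l"
  obtains p where "inj p" "p i = k" "p j = l"
proof
  let ?p = "Transposition.transpose (Transposition.transpose i k j) l \<circ> Transposition.transpose i k"
  show "inj ?p" by (intro inj_compose) simp_all
  show "?p i = k" "?p j = l"
    using assms by (auto simp: Transposition.transpose_def)
qed

lemma crossed_transvection:
  fixes f :: "('n::finite free_group \<Rightarrow> 'n free_group) \<Rightarrow> 'n free_ab"
  assumes f: "crossed f" and f0: "f invert_all = 0"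
  obtains b where "\<And>i j l. i \<noteq> j \<Longrightarrow> coord l (f (transvection i j)) = (if l = j then b else 0)"
proof -
  have gen0: "f (invert_gen k) = 0" for k
    unfolding invert_gen_def by (rule crossed_signed_map_0[OF f f0]) (simp add: inj_def)
  have other: "coord l (f (transvection i j)) = 0" if "i \<noteq> j" "l \<noteq> j" for i j l
  proof -
    let ?R = "transvection i j"
    have R: "?R \<in> auts" by (rule transvection_auts[OF that(1)])
    show ?thesis
    proof (cases "l = i")
      case False
      \<comment> \<open>For \<open>l\<close> different from \<open>i\<close> and \<open>j\<close>
        the sign change commutes with the transvection, so the value of \<open>f\<close> there is
        fixed by an action that negates coordinate \<open>l\<close>.\<close>
      have "?R \<circ> invert_gen l = invert_gen l \<circ> ?R"
        using that False by (intro add_hom_eqI) (auto simp: add_hom_comp add_hom_add add_hom_uminus)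
      then have "ab_act ?R (f (invert_gen l)) + f ?R = ab_act (invert_gen l) (f ?R) + f (invert_gen l)"
        using crossedD[OF f _ R, of "invert_gen l"] crossedD[OF f R, of "invert_gen l"] by simp
      then have "coord l (f ?R) = coord l (ab_act (invert_gen l) (f ?R))"
        by (simp add: gen0 ab_act_zero)
      then show ?thesis by (simp add: coord_ab_act_invert)
    next
      case True
      \<comment> \<open>Conjugation by the sign change at \<open>j\<close> inverts the transvection.
        Neither action alters coordinate \<open>i\<close>, so the cocycle identity at the identity
        says that twice this coordinate is zero.\<close>
      let ?g = "invert_gen j \<circ> (?R \<circ> invert_gen j)"
      have "?R \<circ> ?g = id"
        using that by (intro add_hom_eqI add_hom_comp auts_add_hom[OF id_auts])
          (auto simp: add_hom_add add_hom_uminus add_hom_diff)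
      moreover have "f (?R \<circ> ?g) = ab_act ?R (ab_act (invert_gen j) (f ?R)) + f ?R"
        by (simp add: crossedD[OF f] R comp_auts gen0 ab_act_zero)
      ultimately have "coord i (ab_act ?R (ab_act (invert_gen j) (f ?R)) + f ?R) = 0"
        using crossed_id[OF f] by simp
      then show ?thesis
        using that True by (simp add: coord_ab_act_transvection coord_ab_act_invert)
    qed
  qed
  have same: "coord l (f (transvection k l)) = coord j (f (transvection i j))"
    if "i \<noteq> j" "k \<noteq> l" for i j k l
  proof -
    obtain p where p: "inj p" "p i = k" "p j = l"
      using ex_permutation_two_points[OF \<open>i \<noteq> j\<close> \<open>k \<noteq> l\<close>] .
    let ?s = "\<lambda>m. (p m, True)"
    have inj: "inj (fst \<circ> ?s)" using p(1) by (simp add: comp_def)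
    have s: "signed_map ?s \<in> auts" by (rule signed_map_auts[OF inj])
    have s0: "f (signed_map ?s) = 0" by (rule crossed_signed_map_0[OF f f0 inj])
    have "signed_map ?s \<circ> transvection i j = transvection k l \<circ> signed_map ?s"
      using p by (intro add_hom_eqI add_hom_comp) (auto simp: letter_True add_hom_add inj_eq)
    then have "ab_act (signed_map ?s) (f (transvection i j)) = f (transvection k l)"
      using crossedD[OF f transvection_auts[OF that(1)] s] crossedD[OF f s transvection_auts[OF that(2)]]
      by (simp only: s0 ab_act_zero[OF add_hom_transvection] add_0 add_0_right)
    then show ?thesis
      using coord_ab_act_signed_map[OF inj, of j "f (transvection i j)"] p(3) by simp
  qed
  show thesis
  proof (cases "\<exists>i j :: 'n. i \<noteq> j")
    case True
    then obtain i j :: 'n where "i \<noteq> j" by blast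
    show thesis
    proof (rule that)
      fix k l m :: 'n
      assume "k \<noteq> l"
      then show "coord m (f (transvection k l)) = (if m = l then coord j (f (transvection i j)) else 0)"
        using other[of k l m] same[OF \<open>i \<noteq> j\<close>, of k l] by simp
    qed
  next
    case False
    \<comment> \<open>In rank one there are no transvections and any constant will do.\<close>
    then show thesis using that[of 0] by blast
  qed
qed

theorem crossed_classification:
  fixes f :: "('n::finite free_group \<Rightarrow> 'n free_group) \<Rightarrow> 'n free_ab"
  assumes f: "crossed f"
  obtains m h where "\<And>\<sigma>. \<sigma> \<in> auts \<Longrightarrow> f \<sigma> = int_scale m (morita \<sigma>) + (ab_act \<sigma> h - h)"
proof -
  obtain i0 :: 'n where True by simp
  define a where "a = f invert_all"
  \<comment> \<open>A coboundary takes the value \<open>- 2 h\<close> at \<open>invert_all\<close>,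
    so it can remove everything from \<open>a\<close> except the common parity \<open>c\<close> of
    its coordinates.\<close>
  define c where "c = coord i0 a mod 2"
  obtain b where b: "\<And>j. coord j b = (coord j a - c) div 2"
    by (rule coord_surj[of "\<lambda>j. (coord j a - c) div 2"]) blast
  have a: "coord j a = 2 * coord j b + c" for j
  proof -
    have "even (coord j a - coord i0 a)"
      unfolding a_def by (rule crossed_invert_all_parity[OF f])
    then have "even (coord j a - c)"
      unfolding c_def by presburger
    then show ?thesis by (simp add: b)
  qed
  obtain u :: "'n free_ab" where u: "\<And>j. coord j u = 1"
    by (rule coord_surj[of "\<lambda>_. 1"]) blast
  \<comment> \<open>At \<open>invert_all\<close> each coordinate receives \<open>- c\<close> from
    the \<open>morita\<close> term and minus twice the coordinate of \<open>b\<close> from the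
    coboundary, cancelling the value of \<open>f\<close>.\<close>
  define g where "g = (\<lambda>\<sigma>. f \<sigma> + int_scale c (morita \<sigma>) + (ab_act \<sigma> b - b))"
  have g: "crossed g"
    unfolding g_def by (intro crossed_add f crossed_int_scale crossed_morita crossed_principal)
  have "g invert_all = 0"
    by (rule coord_eqI)
       (simp add: g_def coord_morita_invert_all ab_act_invert_all a flip: a_def)
  from crossed_transvection[OF g this] obtain d
    where d: "\<And>i j l. i \<noteq> j \<Longrightarrow> coord l (g (transvection i j)) = (if l = j then d else 0)" by blast
  \<comment> \<open>The two corrections cancel at \<open>invert_all\<close>. On
    \<open>transvection i j\<close> the \<open>morita\<close> term vanishes and the coboundary of
    \<open>- d u\<close> is \<open>- d\<close> in coordinate \<open>j\<close>, which removes the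
    value left in \<open>g\<close>.\<close>
  define q where "q = (\<lambda>\<sigma>. g \<sigma> + int_scale (2 * d) (morita \<sigma>) + (ab_act \<sigma> (int_scale (- d) u) - int_scale (- d) u))"
  have q: "crossed q"
    unfolding q_def by (intro crossed_add g crossed_int_scale crossed_morita crossed_principal)
  have q0: "q invert_all = 0"
    by (rule coord_eqI) (simp add: q_def \<open>g invert_all = 0\<close> coord_morita_invert_all ab_act_invert_all u)
  have "q \<sigma> = 0" if "\<sigma> \<in> auts" for \<sigma>
  proof (rule crossed_eqI[OF q crossed_zero _ _ that])
    show "q (signed_map s) = 0" if "inj (fst \<circ> s)" for s
      by (rule crossed_signed_map_0[OF q q0 that])
    show "q (transvection i j) = 0" if "i \<noteq> j" for i j
      using that by (intro coord_eqI)
        (simp add: q_def d morita_transvection coord_ab_act_transvection u)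
  qed
  then have "f \<sigma> = int_scale (- c - 2 * d) (morita \<sigma>)
      + (ab_act \<sigma> (int_scale d u - b) - (int_scale d u - b))" if "\<sigma> \<in> auts" for \<sigma>
  proof -
    have "add_hom \<sigma>" using that by (rule auts_add_hom)
    have "coord j (q \<sigma>) = 0" for j
      using \<open>\<And>\<sigma>. \<sigma> \<in> auts \<Longrightarrow> q \<sigma> = 0\<close>[OF that] by simp
    then show ?thesis
      by (intro coord_eqI)
         (simp add: q_def g_def ab_act_diff[OF \<open>add_hom \<sigma>\<close>] ab_act_int_scale[OF \<open>add_hom \<sigma>\<close>] algebra_simps)
  qed
  then show thesis by (rule that)
qed

text \<open>On transvections \<open>morita\<close> vanishes, which forces every coordinate of
  \<open>h\<close> to be zero; this needs a second index. In rank one twice f_M would be a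
  coboundary. Evaluation at \<open>invert_all\<close> then gives \<open>m = 0\<close>.\<close>

lemma morita_multiple_not_principal:
  fixes h :: "'n::finite free_ab"
  assumes "CARD('n) \<ge> 2"
    and eq: "\<And>\<sigma>. \<sigma> \<in> auts \<Longrightarrow> int_scale m (morita \<sigma>) = ab_act \<sigma> h - h"
  shows "m = 0"
proof -
  have "coord i h = 0" for i
  proof -
    obtain j where "i \<noteq> j"
      using assms(1) by (metis UNIV_I card_2_iff' card_le_Suc0_iff_eq finite not_less_eq_eq numeral_2_eq_2)
    then have "int_scale m 0 = ab_act (transvection i j) h - h"
      using eq[OF transvection_auts] by (simp add: morita_transvection)
    then have "coord j (int_scale m 0) = coord j (ab_act (transvection i j) h - h)"
      by (rule arg_cong)
    then show ?thesis by (simp add: coord_ab_act_transvection)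
  qed
  then have "h = 0" by (intro coord_eqI) simp
  with eq[of invert_all] have "int_scale m (morita invert_all) = (0 :: 'n free_ab)"
    by (simp add: ab_act_zero)
  then have "coord undefined (int_scale m (morita invert_all) :: 'n free_ab) = 0"
    by simp
  then show ?thesis by (simp add: coord_morita_invert_all)
qed

section \<open>Descent to automorphisms of nilpotent quotients\<close>

text \<open>The index is shifted: \<open>lcs k\<close> is the subgroup divided out in
  \<open>N_grp k\<close>, so \<open>lcs 1\<close> is the derived subgroup and \<open>lcs 2\<close>
  is the third term of the lower central series.\<close>

abbreviation lcs :: "nat \<Rightarrow> 'n free_group set" where
  "lcs k \<equiv> lower_central free_grp (Suc k)"

lemma lcs_0: "lcs 0 = UNIV"
  by (simp add: lower_central_def)

lemma lcs_Suc: "lcs (Suc k) = generate free_grp (\<Union>x\<in>lcs k. \<Union>y. {x + y - x - y})"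
  by (simp add: lower_central_def commutators_def)

lemma lcs_1: "lcs 1 = derived free_grp UNIV"
  by (simp add: lcs_Suc lcs_0 derived_def)

text \<open>Full invariance rather than mere normality: it lets automorphisms act on cosets, and
  normality follows by applying it to conjugations.\<close>

lemma add_hom_lcs:
  assumes "add_hom \<phi>"
  shows "x \<in> lcs k \<Longrightarrow> \<phi> x \<in> lcs k"
proof (induction k arbitrary: x)
  case 0
  show ?case by (simp add: lcs_0)
next
  case (Suc k)
  from Suc.prems show ?case unfolding lcs_Suc
  proof (induction rule: generate.induct)
    case one
    then show ?case
      using generate.one[of free_grp] by (simp add: add_hom_zero[OF assms])
  next
    case (incl h)
    then obtain x y where "x \<in> lcs k" "h = x + y - x - y" by auto
    then have "\<phi> x \<in> lcs k" "\<phi> h = \<phi> x + \<phi> y - \<phi> x - \<phi> y"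
      by (auto simp: Suc.IH add_hom_add[OF assms] add_hom_diff[OF assms])
    then show ?case by (intro generate.incl) blast
  next
    case (inv h)
    then obtain x y where "x \<in> lcs k" "h = x + y - x - y" by auto
    then have *: "\<phi> x \<in> lcs k" "\<phi> h = \<phi> x + \<phi> y - \<phi> x - \<phi> y"
      by (auto simp: Suc.IH add_hom_add[OF assms] add_hom_diff[OF assms])
    have "\<phi> (inv\<^bsub>free_grp\<^esub> h) = inv\<^bsub>free_grp\<^esub> (\<phi> h)"
      by (simp add: add_hom_uminus[OF assms])
    also have "\<dots> \<in> generate free_grp (\<Union>x\<in>lcs k. \<Union>y. {x + y - x - y})"
      using * by (intro generate.inv) blast
    finally show ?case .
  next
    case (eng g h)
    then show ?case
      using generate.eng by (fastforce simp: add_hom_add[OF assms])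
  qed
qed

lemma lcs_subgroup: "subgroup (lcs k) free_grp"
proof (cases k)
  case 0
  then show ?thesis
    using group.subgroup_self[OF group_F] by (simp add: lcs_0)
next
  case (Suc j)
  show ?thesis
    unfolding Suc lcs_Suc by (rule group.generate_is_subgroup[OF group_F]) simp
qed

lemma lcs_zero: "0 \<in> lcs k"
  and lcs_add: "x \<in> lcs k \<Longrightarrow> y \<in> lcs k \<Longrightarrow> x + y \<in> lcs k"
  and lcs_uminus: "x \<in> lcs k \<Longrightarrow> - x \<in> lcs k"
  using subgroup.one_closed[OF lcs_subgroup, of k] subgroup.m_closed[OF lcs_subgroup, of x k y]
    subgroup.m_inv_closed[OF lcs_subgroup, of x k]
  by simp_all

lemma lcs_conj: "x \<in> lcs k \<Longrightarrow> g + x - g \<in> lcs k"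
proof (rule add_hom_lcs[where \<phi> = "\<lambda>x. g + x - g"])
  show "add_hom (\<lambda>x. g + x - g)"
    by (simp add: add_hom_def diff_conv_add_uminus add.assoc del: add_uminus_conv_diff)
qed

lemma lcs_Suc_subset: "lcs (Suc k) \<subseteq> lcs k"
proof -
  have "x + y - x - y \<in> lcs k" if "x \<in> lcs k" for x y :: "'a free_group"
  proof -
    have "x + (y + - x - y) \<in> lcs k"
      using that by (intro lcs_add lcs_conj lcs_uminus)
    then show ?thesis by (simp add: add_diff_eq)
  qed
  then show ?thesis
    unfolding lcs_Suc by (intro group.generate_subgroup_incl[OF group_F _ lcs_subgroup]) auto
qed

lemma lcs_antimono: "j \<le> k \<Longrightarrow> lcs k \<subseteq> lcs j"
  by (induction k rule: dec_induct) (use lcs_Suc_subset in blast)+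

section \<open>Cosets, induced automorphisms and the product of T\<close>

abbreviation lcoset :: "nat \<Rightarrow> 'n free_group \<Rightarrow> 'n free_group set" where
  "lcoset k w \<equiv> lcs k #>\<^bsub>free_grp\<^esub> w"

lemma mem_lcoset: "v \<in> lcoset k w \<longleftrightarrow> v - w \<in> lcs k"
proof -
  have "v \<in> lcoset k w \<longleftrightarrow> (\<exists>h\<in>lcs k. v = h + w)"
    by (auto simp: r_coset_def)
  also have "\<dots> \<longleftrightarrow> v - w \<in> lcs k"
    by (metis add_diff_cancel diff_add_cancel)
  finally show ?thesis .
qed

lemma lcoset_eq_iff: "lcoset k v = lcoset k w \<longleftrightarrow> v - w \<in> lcs k"
proof
  assume "lcoset k v = lcoset k w"
  then have "v \<in> lcoset k w" by (metis mem_lcoset lcs_zero diff_self)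
  then show "v - w \<in> lcs k" by (simp add: mem_lcoset)
next
  assume *: "v - w \<in> lcs k"
  have "u - v \<in> lcs k \<longleftrightarrow> u - w \<in> lcs k" for u
    using lcs_add[of "u - v" k "v - w"] lcs_add[of "u - w" k "- (v - w)"] * lcs_uminus[OF *]
    by (auto simp: add_diff_eq minus_diff_eq)
  then show "lcoset k v = lcoset k w" by (auto simp: mem_lcoset)
qed

lemma carrier_N_grp: "carrier (N_grp k) = range (lcoset k)"
  by (auto simp: N_grp_def FactGroup_def RCOSETS_def)

lemma aut_image_lcoset:
  assumes "\<sigma> \<in> auts"
  shows "\<sigma> ` lcoset k w = lcoset k (\<sigma> w)"
proof (intro equalityI subsetI)
  fix v assume "v \<in> \<sigma> ` lcoset k w"
  then show "v \<in> lcoset k (\<sigma> w)"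
    by (auto simp: mem_lcoset add_hom_lcs[OF auts_add_hom[OF assms]] simp flip: auts_diff[OF assms])
next
  fix v assume v: "v \<in> lcoset k (\<sigma> w)"
  let ?\<tau> = "inv_into UNIV \<sigma>"
  have \<tau>: "?\<tau> \<in> auts" by (rule inv_auts[OF assms])
  have "?\<tau> (v - \<sigma> w) \<in> lcs k"
    using v by (intro add_hom_lcs[OF auts_add_hom[OF \<tau>]]) (simp add: mem_lcoset)
  moreover have "?\<tau> (\<sigma> w) = w" "\<sigma> (?\<tau> v) = v"
    using auts_comp_inv[OF assms] by (auto simp: fun_eq_iff)
  ultimately have "?\<tau> v \<in> lcoset k w"
    by (simp add: mem_lcoset auts_diff[OF \<tau>])
  with \<open>\<sigma> (?\<tau> v) = v\<close> show "v \<in> \<sigma> ` lcoset k w"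
    by (metis imageI)
qed

lemma induced_lcoset: "\<sigma> \<in> auts \<Longrightarrow> induced k \<sigma> (lcoset k w) = lcoset k (\<sigma> w)"
  by (simp add: induced_def carrier_N_grp aut_image_lcoset)

lemma induced_eqD:
  "\<sigma> \<in> auts \<Longrightarrow> \<tau> \<in> auts \<Longrightarrow> induced k \<sigma> = induced k \<tau> \<Longrightarrow> \<sigma> w - \<tau> w \<in> lcs k"
  by (metis induced_lcoset lcoset_eq_iff)

lemma carrier_Aut_free: "carrier (Aut free_grp) = auts"
  by (auto simp: Aut_def opposite_group_def AutoGroup_def auto_def Bij_def hom_def auts_def add_hom_def)

lemma carrier_T_grp: "carrier (T_grp k) = induced k ` auts"
  by (simp add: T_grp_def carrier_Aut_free)

lemma induced_Bij: "\<sigma> \<in> auts \<Longrightarrow> induced k \<sigma> \<in> Bij (carrier (N_grp k))"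
proof -
  assume \<sigma>: "\<sigma> \<in> auts"
  let ?\<tau> = "inv_into UNIV \<sigma>"
  have \<tau>: "?\<tau> \<in> auts" by (rule inv_auts[OF \<sigma>])
  have *: "?\<tau> (\<sigma> w) = w" "\<sigma> (?\<tau> w) = w" for w
    using auts_comp_inv[OF \<sigma>] by (auto simp: fun_eq_iff)
  have "bij_betw (induced k \<sigma>) (carrier (N_grp k)) (carrier (N_grp k))"
    by (rule bij_betw_byWitness[where f' = "induced k ?\<tau>"])
       (auto simp: carrier_N_grp induced_lcoset \<sigma> \<tau> *)
  then show ?thesis by (simp add: Bij_def induced_def)
qed

lemma T_grp_mult:
  assumes "\<sigma> \<in> auts" "\<tau> \<in> auts"
  shows "induced k \<sigma> \<otimes>\<^bsub>T_grp k\<^esub> induced k \<tau> = induced k (\<tau> \<circ> \<sigma>)"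
proof -
  have "induced k \<sigma> \<otimes>\<^bsub>T_grp k\<^esub> induced k \<tau> = compose (carrier (N_grp k)) (induced k \<tau>) (induced k \<sigma>)"
    using assms by (simp add: T_grp_def Aut_def opposite_group_def AutoGroup_def BijGroup_def induced_Bij)
  also have "\<dots> = induced k (\<tau> \<circ> \<sigma>)"
  proof
    fix X
    show "compose (carrier (N_grp k)) (induced k \<tau>) (induced k \<sigma>) X = induced k (\<tau> \<circ> \<sigma>) X"
    proof (cases "X \<in> carrier (N_grp k)")
      case True
      then obtain w where "X = lcoset k w" by (auto simp: carrier_N_grp)
      with True show ?thesis
        using assms by (simp add: compose_def induced_lcoset comp_auts)
    qed (simp add: compose_def induced_def)
  qed
  finally show ?thesis .
qed

lemma descend_induced:
  assumes "\<sigma> \<in> auts" "\<And>\<tau>. \<tau> \<in> auts \<Longrightarrow> induced k \<tau> = induced k \<sigma> \<Longrightarrow> \<phi> \<tau> = \<phi> \<sigma>"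
  shows "descend k \<phi> (induced k \<sigma>) = \<phi> \<sigma>"
proof -
  have "\<phi> ` {\<tau> \<in> auts. induced k \<tau> = induced k \<sigma>} = {\<phi> \<sigma>}"
    using assms by blast
  with assms(1) show ?thesis
    by (simp add: descend_def carrier_T_grp carrier_Aut_free)
qed

lemma ab_act_induced_cong:
  assumes "k \<ge> 1" "\<sigma> \<in> auts" "\<tau> \<in> auts" "induced k \<sigma> = induced k \<tau>"
  shows "ab_act \<sigma> = ab_act \<tau>"
proof
  fix h
  show "ab_act \<sigma> h = ab_act \<tau> h"
  proof (cases h rule: ab_class_cases)
    case (ab_class w)
    have "\<sigma> w - \<tau> w \<in> derived free_grp UNIV"
      using induced_eqD[OF assms(2-4), of w] lcs_antimono[OF assms(1)] unfolding lcs_1 by blast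
    then show ?thesis
      using assms by (simp add: ab_class auts_add_hom ab_class_eq_iff)
  qed
qed

lemma T_act_induced: "k \<ge> 1 \<Longrightarrow> \<sigma> \<in> auts \<Longrightarrow> T_act k (induced k \<sigma>) = ab_act \<sigma>"
  unfolding T_act_def by (rule descend_induced) (auto intro: ab_act_induced_cong)

section \<open>The group ring modulo the square of its augmentation ideal\<close>

definition augmentation :: "('n free_ab \<Rightarrow>\<^sub>0 int) \<Rightarrow> int" where
  "augmentation = Z_linear_extension (\<lambda>_. 1)"

text \<open>Together with \<open>augmentation\<close> the moments are the coordinates of the
  quotient of Z[H] by the square of the augmentation ideal, which is the direct sum of Z and H. On a
  group element they recover its coordinates in H.\<close>

definition moment :: "'n \<Rightarrow> ('n free_ab \<Rightarrow>\<^sub>0 int) \<Rightarrow> int" where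
  "moment l = Z_linear_extension (coord l)"

lemma augmentation_simps [simp]:
  "augmentation (p + q) = augmentation p + augmentation q"
  "augmentation (p * q) = augmentation p * augmentation q"
  "augmentation 0 = 0" "augmentation 1 = 1" "augmentation (ring_elem h) = 1"
  by (simp_all add: augmentation_def Z_linear_extension_add Z_linear_extension_mult Z_linear_extension_one)

lemma moment_simps [simp]:
  "moment l (p + q) = moment l p + moment l q"
  "moment l 0 = 0" "moment l (ring_elem h) = coord l h"
  by (simp_all add: moment_def Z_linear_extension_add)

lemma moment_mult [simp]: "moment l (p * q) = moment l p * augmentation q + augmentation p * moment l q"
proof (induction p rule: poly_mapping_add_induct)
  case (single x m)
  show ?case
  proof (induction q rule: poly_mapping_add_induct)
    case (single y n)
    show ?case by (simp add: mult_single moment_def augmentation_def algebra_simps)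
  qed (simp_all add: algebra_simps)
qed (simp_all add: algebra_simps)

text \<open>Congruence modulo the square of the augmentation ideal of \<open>Z[H]\<close>.\<close>

definition cong_I2 :: "('n free_ab \<Rightarrow>\<^sub>0 int) \<Rightarrow> ('n free_ab \<Rightarrow>\<^sub>0 int) \<Rightarrow> bool" where
  "cong_I2 p q \<longleftrightarrow> augmentation p = augmentation q \<and> (\<forall>l. moment l p = moment l q)"

lemma cong_I2_refl [simp]: "cong_I2 p p"
  by (simp add: cong_I2_def)

lemma cong_I2_mult: "cong_I2 p q \<Longrightarrow> cong_I2 p' q' \<Longrightarrow> cong_I2 (p * p') (q * q')"
  by (simp add: cong_I2_def)

lemma cong_I2_sum: "(\<And>x. x \<in> A \<Longrightarrow> cong_I2 (f x) (g x)) \<Longrightarrow> cong_I2 (sum f A) (sum g A)"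
  by (induction A rule: infinite_finite_induct) (simp_all add: cong_I2_def)

lemma cong_I2_prod: "(\<And>x. x \<in> A \<Longrightarrow> cong_I2 (f x) (g x)) \<Longrightarrow> cong_I2 (prod f A) (prod g A)"
  by (induction A rule: infinite_finite_induct) (simp_all add: cong_I2_def)

lemma cong_I2_det: "(\<And>i j. cong_I2 (A $ i $ j) (B $ i $ j)) \<Longrightarrow> cong_I2 (det A) (det B)"
  unfolding det_def by (intro cong_I2_sum cong_I2_mult cong_I2_prod cong_I2_refl)

lemma augmentation_fox_ab: "augmentation (fox_ab j w) = expsum j w"
proof -
  have "(\<lambda>w. augmentation (fox_ab j w)) = expsum j"
    by (rule add_hom_eqI) (auto simp: add_hom_def fox_ab_add expsum_add)
  then show ?thesis by (rule fun_cong)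
qed

text \<open>This is the degree-two coefficient of the Magnus expansion: additive up to a product of
  exponent sums, and so additive as soon as one factor lies in the derived subgroup.\<close>

lemma moment_fox_ab_add:
  "moment l (fox_ab j (x + y)) = moment l (fox_ab j x) + moment l (fox_ab j y) + expsum l x * expsum j y"
  by (simp add: fox_ab_add augmentation_fox_ab)

lemma moment_fox_ab_zero: "moment l (fox_ab j 0) = 0"
  by (simp add: ring_cocycle_zero[OF ring_cocycle_fox_ab])

lemma moment_fox_ab_uminus:
  "moment l (fox_ab j (- x)) = - moment l (fox_ab j x) + expsum l x * expsum j x"
  using moment_fox_ab_add[of l j "- x" x] by (simp add: moment_fox_ab_zero expsum_uminus)

lemma expsum_lcs_2: "v \<in> lcs 2 \<Longrightarrow> expsum j v = 0"
  using lcs_antimono[of 1 2] expsum_derived[of v j] unfolding lcs_1 by auto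

text \<open>The first entry of a generating commutator lies in the derived subgroup, so every
  quadratic correction that involves it vanishes, and the two coming from \<open>y\<close> and its
  inverse cancel.\<close>

lemma moment_fox_ab_lcs_2:
  assumes "v \<in> lcs 2"
  shows "moment l (fox_ab j v) = 0"
proof -
  have comm: "moment l (fox_ab j (x + y - x - y)) = 0" "expsum i (x + y - x - y) = 0"
    if "x \<in> lcs 1" for i and x y :: "'a free_group"
  proof -
    have "expsum i x = 0" for i
      using that expsum_derived[of x i] by (simp only: lcs_1)
    then show "moment l (fox_ab j (x + y - x - y)) = 0" "expsum i (x + y - x - y) = 0"
      by (simp_all add: diff_conv_add_uminus moment_fox_ab_add moment_fox_ab_uminus expsum_add expsum_uminus
          del: add_uminus_conv_diff)
  qed
  have "v \<in> generate free_grp (\<Union>x\<in>lcs 1. \<Union>y. {x + y - x - y})"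
    using assms by (simp only: lcs_Suc numeral_2_eq_2 One_nat_def)
  \<comment> \<open>The exponent sums are carried along because the moment of a product involves
    them.\<close>
  then have "moment l (fox_ab j v) = 0 \<and> (\<forall>i. expsum i v = 0)"
    by (induction rule: generate.induct)
       (use comm in \<open>auto simp: moment_fox_ab_zero expsum_zero moment_fox_ab_uminus moment_fox_ab_add
           expsum_uminus expsum_add simp del: One_nat_def\<close>)
  then show ?thesis by blast
qed

text \<open>For \<open>k \<ge> 2\<close> the images of a generator differ by a factor in the third
  term of the lower central series, so corresponding Magnus entries agree modulo the square of the
  augmentation ideal. So do the determinants, and a group element can be recovered from its
  residue.\<close>

lemma morita_induced_cong:
  fixes \<sigma> \<tau> :: "'n::finite free_group \<Rightarrow> 'n free_group"
  assumes "k \<ge> 2" "\<sigma> \<in> auts" "\<tau> \<in> auts" "induced k \<sigma> = induced k \<tau>"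
  shows "morita \<sigma> = morita \<tau>"
proof -
  have "cong_I2 (magnus \<sigma> $ i $ j) (magnus \<tau> $ i $ j)" for i j
  proof -
    define v where "v = \<sigma> (gen i) - \<tau> (gen i)"
    have v: "v \<in> lcs 2"
      unfolding v_def using induced_eqD[OF assms(2-4)] lcs_antimono[OF assms(1)] by blast
    have "\<sigma> (gen i) = v + \<tau> (gen i)" by (simp add: v_def)
    then show ?thesis
      using v by (simp add: cong_I2_def magnus_nth moment_fox_ab_add augmentation_fox_ab expsum_add
          moment_fox_ab_lcs_2 expsum_lcs_2)
  qed
  then have "cong_I2 (det (magnus \<sigma>)) (det (magnus \<tau>))"
    by (rule cong_I2_det)
  moreover have "det_sgn \<sigma> = det_sgn \<tau>"
    using ab_act_induced_cong[of k \<sigma> \<tau>] assms by (simp add: det_sgn_def)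
  ultimately have "cong_I2 (ring_elem (morita \<sigma>)) (ring_elem (morita \<tau>))"
    by (simp add: ring_elem_morita assms signed_det_def cong_I2_mult)
  then show ?thesis
    by (intro coord_eqI) (simp add: cong_I2_def)
qed

lemma morita_T_induced: "k \<ge> 2 \<Longrightarrow> \<sigma> \<in> auts \<Longrightarrow> morita_T k (induced k \<sigma>) = morita \<sigma>"
  unfolding morita_T_def by (rule descend_induced) (auto intro: morita_induced_cong)

section \<open>The first cohomology group\<close>

locale right_module =
  fixes G :: "('g, 'b) monoid_scheme" and act :: "'g \<Rightarrow> 'm::ab_group_add \<Rightarrow> 'm"
  assumes closed: "\<sigma> \<in> carrier G \<Longrightarrow> \<tau> \<in> carrier G \<Longrightarrow> \<sigma> \<otimes>\<^bsub>G\<^esub> \<tau> \<in> carrier G"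
    and act_hom: "\<sigma> \<in> carrier G \<Longrightarrow> add_hom (act \<sigma>)"
    and act_mult: "\<sigma> \<in> carrier G \<Longrightarrow> \<tau> \<in> carrier G \<Longrightarrow> act (\<sigma> \<otimes>\<^bsub>G\<^esub> \<tau>) m = act \<tau> (act \<sigma> m)"
begin

lemmas act_add = add_hom_add[OF act_hom]
  and act_zero = add_hom_zero[OF act_hom]
  and act_uminus = add_hom_uminus[OF act_hom]
  and act_diff = add_hom_diff[OF act_hom]

lemma mult_Z1: "f \<otimes>\<^bsub>Z1 G act\<^esub> g = (\<lambda>\<sigma>\<in>carrier G. f \<sigma> + g \<sigma>)"
  and one_Z1: "\<one>\<^bsub>Z1 G act\<^esub> = (\<lambda>\<sigma>\<in>carrier G. 0)"
  by (simp_all add: Z1_def)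

lemma mem_Z1:
  "f \<in> carrier (Z1 G act) \<longleftrightarrow> f \<in> extensional (carrier G) \<and>
    (\<forall>\<sigma>\<in>carrier G. \<forall>\<tau>\<in>carrier G. f (\<sigma> \<otimes>\<^bsub>G\<^esub> \<tau>) = act \<tau> (f \<sigma>) + f \<tau>)"
  by (simp add: Z1_def)

lemma comm_group_Z1: "comm_group (Z1 G act)"
proof (rule comm_groupI)
  fix f assume f: "f \<in> carrier (Z1 G act)"
  have "(\<lambda>\<sigma>\<in>carrier G. - f \<sigma>) \<in> carrier (Z1 G act)"
    using f by (auto simp: mem_Z1 closed act_uminus)
  moreover have "(\<lambda>\<sigma>\<in>carrier G. - f \<sigma>) \<otimes>\<^bsub>Z1 G act\<^esub> f = \<one>\<^bsub>Z1 G act\<^esub>"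
    by (auto simp: mult_Z1 one_Z1)
  ultimately show "\<exists>g\<in>carrier (Z1 G act). g \<otimes>\<^bsub>Z1 G act\<^esub> f = \<one>\<^bsub>Z1 G act\<^esub>"
    by blast
qed (auto simp: mem_Z1 mult_Z1 one_Z1 closed act_add act_zero algebra_simps extensional_def)

lemma group_Z1: "group (Z1 G act)"
  by (rule comm_group.axioms(2)[OF comm_group_Z1])

lemma B1_subset_Z1: "B1 G act \<subseteq> carrier (Z1 G act)"
  by (auto simp: B1_def mem_Z1 closed act_mult act_diff)

lemma B1_normal: "B1 G act \<lhd> Z1 G act"
proof (rule comm_group.subgroup_imp_normal[OF comm_group_Z1])
  show "subgroup (B1 G act) (Z1 G act)"
  proof (rule group.subgroupI[OF group_Z1 B1_subset_Z1])
    show "B1 G act \<noteq> {}" by (simp add: B1_def)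
  next
    fix f assume "f \<in> B1 G act"
    then obtain m where f: "f = (\<lambda>\<sigma>\<in>carrier G. act \<sigma> m - m)" by (auto simp: B1_def)
    have "(\<lambda>\<sigma>\<in>carrier G. act \<sigma> (- m) - (- m)) \<in> B1 G act"
      unfolding B1_def by (rule rangeI)
    moreover have "inv\<^bsub>Z1 G act\<^esub> f = (\<lambda>\<sigma>\<in>carrier G. act \<sigma> (- m) - (- m))"
    proof (rule group.inv_equality[OF group_Z1])
      show "(\<lambda>\<sigma>\<in>carrier G. act \<sigma> (- m) - (- m)) \<otimes>\<^bsub>Z1 G act\<^esub> f = \<one>\<^bsub>Z1 G act\<^esub>"
        by (auto simp: f mult_Z1 one_Z1 act_uminus)
    qed (use B1_subset_Z1 \<open>f \<in> B1 G act\<close> calculation in auto)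
    ultimately show "inv\<^bsub>Z1 G act\<^esub> f \<in> B1 G act" by simp
  next
    fix f g assume "f \<in> B1 G act" "g \<in> B1 G act"
    then obtain m n where fg: "f = (\<lambda>\<sigma>\<in>carrier G. act \<sigma> m - m)" "g = (\<lambda>\<sigma>\<in>carrier G. act \<sigma> n - n)"
      by (auto simp: B1_def)
    have "f \<otimes>\<^bsub>Z1 G act\<^esub> g = (\<lambda>\<sigma>\<in>carrier G. act \<sigma> (m + n) - (m + n))"
      by (auto simp: fg mult_Z1 act_add)
    then show "f \<otimes>\<^bsub>Z1 G act\<^esub> g \<in> B1 G act" by (auto simp: B1_def)
  qed
qed

lemma group_H1: "group (H1 G act)"
  unfolding H1_def by (rule normal.factorgroup_is_group[OF B1_normal])

lemma H1_class_hom: "H1_class G act \<in> hom (Z1 G act) (H1 G act)"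
  unfolding H1_class_def[abs_def] H1_def by (rule normal.r_coset_hom_Mod[OF B1_normal])

lemma H1_class_surj: "X \<in> carrier (H1 G act) \<Longrightarrow> \<exists>f\<in>carrier (Z1 G act). X = H1_class G act f"
  by (auto simp: H1_def FactGroup_def RCOSETS_def H1_class_def)

lemma H1_class_eq_one_iff:
  assumes "f \<in> carrier (Z1 G act)"
  shows "H1_class G act f = \<one>\<^bsub>H1 G act\<^esub> \<longleftrightarrow> f \<in> B1 G act"
  using group.coset_join1[OF group_Z1 _ assms] group.coset_join2[OF group_Z1 assms]
    normal_imp_subgroup[OF B1_normal]
  by (auto simp: H1_class_def H1_def FactGroup_def subgroup.subset)

text \<open>Spanning makes the powers of the class of \<open>f\<close> exhaust the quotient, and
  \<open>inf\<close> makes them distinct, so the exponent is an isomorphism with the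
  integers.\<close>

lemma H1_infinite_cyclic:
  assumes f: "f \<in> carrier (Z1 G act)"
    and span: "\<And>g. g \<in> carrier (Z1 G act) \<Longrightarrow> \<exists>m::int. \<exists>b\<in>B1 G act. g = b \<otimes>\<^bsub>Z1 G act\<^esub> (f [^]\<^bsub>Z1 G act\<^esub> m)"
    and inf: "\<And>m::int. f [^]\<^bsub>Z1 G act\<^esub> m \<in> B1 G act \<Longrightarrow> m = 0"
  shows "H1 G act \<cong> integer_group" "carrier (H1 G act) = generate (H1 G act) {H1_class G act f}"
proof -
  interpret Z: group "Z1 G act" by (rule group_Z1)
  interpret H: group "H1 G act" by (rule group_H1)
  interpret c: group_hom "Z1 G act" "H1 G act" "H1_class G act"
    by (intro group_hom.intro group_hom_axioms.intro H1_class_hom group_Z1 group_H1)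
  let ?x = "H1_class G act f"
  have x: "?x \<in> carrier (H1 G act)" using f by simp
  have pow: "?x [^]\<^bsub>H1 G act\<^esub> m = H1_class G act (f [^]\<^bsub>Z1 G act\<^esub> m)" for m :: int
    using f by (simp add: c.hom_int_pow)
  have surj: "X \<in> range (\<lambda>m::int. ?x [^]\<^bsub>H1 G act\<^esub> m)" if X: "X \<in> carrier (H1 G act)" for X
  proof -
    obtain g where g: "g \<in> carrier (Z1 G act)" "X = H1_class G act g"
      using H1_class_surj[OF X] by blast
    with span obtain m b where b: "b \<in> B1 G act" "g = b \<otimes>\<^bsub>Z1 G act\<^esub> (f [^]\<^bsub>Z1 G act\<^esub> (m :: int))"
      by blast
    then have bZ: "b \<in> carrier (Z1 G act)" using B1_subset_Z1 by blast
    with b(1) have "H1_class G act b = \<one>\<^bsub>H1 G act\<^esub>" by (simp add: H1_class_eq_one_iff)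
    then have "X = ?x [^]\<^bsub>H1 G act\<^esub> m"
      using g b bZ f by (simp add: pow)
    then show ?thesis by blast
  qed
  then show gen: "carrier (H1 G act) = generate (H1 G act) {?x}"
    using x by (auto simp: H.generate_pow)
  have "(\<lambda>m::int. ?x [^]\<^bsub>H1 G act\<^esub> m) \<in> iso integer_group (H1 G act)"
  proof (rule isoI[OF H.hom_integer_group_pow[OF x]])
    have "inj (\<lambda>m::int. ?x [^]\<^bsub>H1 G act\<^esub> m)"
    proof (rule injI)
      fix m n :: int
      assume "?x [^]\<^bsub>H1 G act\<^esub> m = ?x [^]\<^bsub>H1 G act\<^esub> n"
      then have "?x [^]\<^bsub>H1 G act\<^esub> (m - n) = \<one>\<^bsub>H1 G act\<^esub>"
        using x by (simp add: H.int_pow_diff)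
      then have "f [^]\<^bsub>Z1 G act\<^esub> (m - n) \<in> B1 G act"
        using f by (simp add: pow H1_class_eq_one_iff)
      then show "m = n" using inf by fastforce
    qed
    moreover have "range (\<lambda>m::int. ?x [^]\<^bsub>H1 G act\<^esub> m) = carrier (H1 G act)"
      using surj x by auto
    ultimately show "bij_betw (\<lambda>m::int. ?x [^]\<^bsub>H1 G act\<^esub> m) (carrier integer_group) (carrier (H1 G act))"
      by (simp add: bij_betw_def)
  qed
  then show "H1 G act \<cong> integer_group"
    using group.iso_sym[OF group_integer_group] is_isoI by blast
qed

end

lemma right_module_T:
  assumes "k \<ge> 1"
  shows "right_module (T_grp k) (T_act k)"
proof
  fix \<sigma> \<tau> :: "'a free_group set \<Rightarrow> 'a free_group set"
  assume "\<sigma> \<in> carrier (T_grp k)"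
  then obtain s where s: "s \<in> auts" "\<sigma> = induced k s" by (auto simp: carrier_T_grp)
  then show "add_hom (T_act k \<sigma>)"
    using assms by (simp add: T_act_induced add_hom_ab_act auts_add_hom)
  assume "\<tau> \<in> carrier (T_grp k)"
  then obtain t where t: "t \<in> auts" "\<tau> = induced k t" by (auto simp: carrier_T_grp)
  have ts: "t \<circ> s \<in> auts" by (rule comp_auts[OF t(1) s(1)])
  show "\<sigma> \<otimes>\<^bsub>T_grp k\<^esub> \<tau> \<in> carrier (T_grp k)"
    using s t ts by (simp add: T_grp_mult carrier_T_grp)
  show "T_act k (\<sigma> \<otimes>\<^bsub>T_grp k\<^esub> \<tau>) m = T_act k \<tau> (T_act k \<sigma> m)" for m
    using s t ts assms by (simp add: T_grp_mult T_act_induced ab_act_comp auts_add_hom)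
qed

text \<open>Pointwise scaling of \<open>f\<close> is a homomorphism from the integers that sends 1
  to \<open>f\<close>, hence it agrees with taking powers. This links abstract powers in
  \<open>Z1\<close> to the multiples in \<open>crossed_classification\<close>.\<close>

lemma int_pow_Z1:
  fixes f :: "'g \<Rightarrow> 'n::finite free_ab"
  assumes "right_module G act" "f \<in> carrier (Z1 G act)" "\<And>\<sigma> m h. \<sigma> \<in> carrier G \<Longrightarrow> act \<sigma> (int_scale m h) = int_scale m (act \<sigma> h)"
  shows "f [^]\<^bsub>Z1 G act\<^esub> m = (\<lambda>\<sigma>\<in>carrier G. int_scale m (f \<sigma>))"
proof -
  interpret right_module G act by fact
  interpret Z: group "Z1 G act" by (rule group_Z1)
  have add: "int_scale m (g + h) = int_scale m g + int_scale m h" for m and g h :: "'n free_ab"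
    by (rule coord_eqI) (simp add: algebra_simps)
  let ?p = "\<lambda>m. \<lambda>\<sigma>\<in>carrier G. int_scale m (f \<sigma>)"
  have "?p \<in> hom integer_group (Z1 G act)"
  proof (rule homI)
    show "?p m \<in> carrier (Z1 G act)" for m
      using assms(2,3) by (auto simp: mem_Z1 closed add)
    show "?p (m \<otimes>\<^bsub>integer_group\<^esub> n) = ?p m \<otimes>\<^bsub>Z1 G act\<^esub> ?p n" for m n
      by (auto simp: mult_Z1 fun_eq_iff algebra_simps intro!: coord_eqI)
  qed
  then interpret p: group_hom integer_group "Z1 G act" ?p
    by (intro group_hom.intro group_hom_axioms.intro group_integer_group group_Z1)
  have "?p 1 = f"
  proof
    fix \<sigma>
    have "int_scale 1 (f \<sigma>) = f \<sigma>" by (rule coord_eqI) simp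
    then show "?p 1 \<sigma> = f \<sigma>"
      using assms(2) by (auto simp: mem_Z1 extensional_def)
  qed
  then show ?thesis
    using p.hom_int_pow[of 1 m] by simp
qed

theorem proposition6p4:
  fixes k :: nat
  assumes "CARD('n::finite) \<ge> 2" and "k \<ge> 2"
  defines "G \<equiv> (T_grp k :: ('n free_group set \<Rightarrow> 'n free_group set) monoid)"
    and "act \<equiv> (T_act k :: _ \<Rightarrow> 'n free_ab \<Rightarrow> 'n free_ab)"
  shows "H1 G act \<cong> integer_group
    \<and> morita_T k \<in> carrier (Z1 G act)
    \<and> carrier (H1 G act) = generate (H1 G act) {H1_class G act (morita_T k)}"
proof -
  have k: "k \<ge> 1" using assms(2) by simp
  have carr: "carrier G = induced k ` auts" by (simp add: G_def carrier_T_grp)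
  have mult: "induced k \<sigma> \<otimes>\<^bsub>G\<^esub> induced k \<tau> = induced k (\<tau> \<circ> \<sigma>)" if "\<sigma> \<in> auts" "\<tau> \<in> auts" for \<sigma> \<tau>
    using T_grp_mult[OF that] by (simp add: G_def)
  have act: "act (induced k \<sigma>) = ab_act \<sigma>" if "\<sigma> \<in> auts" for \<sigma>
    using T_act_induced[OF k that] by (simp add: act_def)
  have mor: "morita_T k (induced k \<sigma>) = morita \<sigma>" if "\<sigma> \<in> auts" for \<sigma> :: "'n free_group \<Rightarrow> 'n free_group"
    by (rule morita_T_induced[OF assms(2) that])
  have module: "right_module G act"
    unfolding G_def act_def by (rule right_module_T[OF k])
  interpret right_module G act by (rule module)
  have "morita_T k \<in> extensional (carrier G)"
    by (simp add: morita_T_def descend_def G_def)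
  then have M: "morita_T k \<in> carrier (Z1 G act)"
    by (auto simp: mem_Z1 carr mult act mor comp_auts morita_comp)
  have pow: "morita_T k [^]\<^bsub>Z1 G act\<^esub> m = (\<lambda>\<sigma>\<in>carrier G. int_scale m (morita_T k \<sigma>))" for m :: int
    by (rule int_pow_Z1[OF module M]) (auto simp: carr act ab_act_int_scale auts_add_hom)
  have span: "\<exists>m::int. \<exists>b\<in>B1 G act. g = b \<otimes>\<^bsub>Z1 G act\<^esub> (morita_T k [^]\<^bsub>Z1 G act\<^esub> m)"
    if g: "g \<in> carrier (Z1 G act)" for g
  proof -
    \<comment> \<open>The pull-back is a cocycle because product and action of \<open>G\<close> are
      computed on representatives.\<close>
    have "crossed (g \<circ> induced k)"
      using g by (auto simp: crossed_def mem_Z1 carr act simp flip: mult)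
    then obtain m h where mh:
      "\<And>\<sigma>. \<sigma> \<in> auts \<Longrightarrow> (g \<circ> induced k) \<sigma> = int_scale m (morita \<sigma>) + (ab_act \<sigma> h - h)"
      by (rule crossed_classification) blast
    have "g = (\<lambda>\<sigma>\<in>carrier G. act \<sigma> h - h) \<otimes>\<^bsub>Z1 G act\<^esub> (morita_T k [^]\<^bsub>Z1 G act\<^esub> m)"
    proof
      fix \<sigma>
      show "g \<sigma> = ((\<lambda>\<sigma>\<in>carrier G. act \<sigma> h - h) \<otimes>\<^bsub>Z1 G act\<^esub> (morita_T k [^]\<^bsub>Z1 G act\<^esub> m)) \<sigma>"
      proof (cases "\<sigma> \<in> carrier G")
        case True
        then obtain s where "s \<in> auts" "\<sigma> = induced k s" by (auto simp: carr)
        with True mh[of s] show ?thesis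
          by (simp add: mult_Z1 pow act mor)
      next
        case False
        with g show ?thesis by (simp add: mult_Z1 mem_Z1 extensional_def)
      qed
    qed
    moreover have "(\<lambda>\<sigma>\<in>carrier G. act \<sigma> h - h) \<in> B1 G act" by (auto simp: B1_def)
    ultimately show ?thesis by blast
  qed
  have inf: "m = 0" if "morita_T k [^]\<^bsub>Z1 G act\<^esub> m \<in> B1 G act" for m :: int
  proof -
    from that obtain h where h: "(\<lambda>\<sigma>\<in>carrier G. int_scale m (morita_T k \<sigma>)) = (\<lambda>\<sigma>\<in>carrier G. act \<sigma> h - h)"
      by (auto simp: B1_def pow)
    \<comment> \<open>Seen on representatives, the coboundary of \<open>h\<close> on
      \<open>G\<close> is the coboundary of the same \<open>h\<close> on the automorphism
      group.\<close>
    have "int_scale m (morita \<sigma>) = ab_act \<sigma> h - h" if "\<sigma> \<in> auts" for \<sigma>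
      using fun_cong[OF h, of "induced k \<sigma>"] that by (simp add: carr act mor)
    then show ?thesis by (rule morita_multiple_not_principal[OF assms(1)])
  qed
  from H1_infinite_cyclic[OF M span inf] M show ?thesis by blast
qed

end
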